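(* Let $\mathcal{S}$ be a rigid semigroup category. For $F\in\mathcal{S}$ define $$\Psi:\operatorname{Hom}_{\text{Mod-}\mathcal{S}(\mathcal{S},\mathcal{S})}(F\boxtimes-,\mathrm{Id})\to\operatorname{Hom}_{\mathcal{S}\text{-Mod}(\mathcal{S},\mathcal{S})}(-\boxtimes F,\mathrm{Id})$$ by letting $\Psi(\alpha)_{H}:HF\to H$ be the composite $$\Psi(\alpha)_{H}=\varepsilon^{F,l}_{H}\circ(\varepsilon^{F^{\diamond},l}_{HF}\,F^{\diamond})\circ(HFF^{\diamond}\,\alpha_{F^{\diamond\diamond}}\,F^{\diamond})\circ\eta^{F^{\diamond},l}_{HFF^{\diamond}F}\circ\eta^{F,l}_{HF},$$ and $$\Phi:\operatorname{Hom}_{\mathcal{S}\text{-Mod}(\mathcal{S},\mathcal{S})}(-\boxtimes F,\mathrm{Id})\to\operatorname{Hom}_{\text{Mod-}\mathcal{S}(\mathcal{S},\mathcal{S})}(F\boxtimes-,\mathrm{Id})$$ by letting $\Phi(\beta)_{H}:FH\to H$ be the composite $$\Phi(\beta)_{H}=\varepsilon^{{}^{\diamond}F,r}_{H}\circ({}^{\diamond}F\,\varepsilon^{{}^{\diamond\diamond}F,r}_{FH})\circ({}^{\diamond}F\,\beta_{{}^{\diamond\diamond}F}\,{}^{\diamond}F\,F\,H)\circ\eta^{{}^{\diamond\diamond}F,r}_{F\,{}^{\diamond}F\,F\,H}\circ\eta^{{}^{\diamond}F,r}_{FH}.$$ Then $\Psi$ and $\Phi$ are mutually inverse isomorphisms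 of presheaves (in the variable $F$) in $[\mathcal{S}^{\mathrm{op}},\mathbf{Vec}_{\Bbbk}]$.
   Context: $\Bbbk$ is a field; all categories and functors are $\Bbbk$-linear, $\mathcal{S}$ small. A *semigroup category* is a category $\mathcal{S}$ with a bilinear functor $\boxtimes$ and an associativity isomorphism satisfying the pentagon axiom; no unit object is required. Module functors and transformations are defined as for monoidal categories, dropping unit data. Associators are suppressed and $\boxtimes$ is often written as juxtaposition; an object next to a morphism denotes its identity. $\mathcal{S}\text{-Mod}(\mathcal{S},\mathcal{S})$ (resp. $\text{Mod-}\mathcal{S}(\mathcal{S},\mathcal{S})$) is the category of left (resp. right) $\mathcal{S}$-module endofunctors of $\mathcal{S}$; $-\boxtimes F$ is an object of the former and $F\boxtimes-$ of the latter. An *adjunction* in $\mathcal{S}$ is a tuple $(F,F^{\diamond},\eta^{F,l},\eta^{F,r},\varepsilon^{F,l},\varepsilon^{F,r})$ with $F,F^{\diamond}\in\mathcal{S}$, left $\mathcal{S}$-module transformations $\eta^{F,l}:\mathrm{Id}\to -\boxtimes(F^{\diamond}\boxtimes F)$, $\varepsilon^{F,l}:-\boxtimes(F\boxtimes F^{\diamond})\to\mathrm{Id}$, and right $\mathcal{S}$-module transformations $\eta^{F,r}:\mathrm{Id}\to(F^{\diamond}\boxtimes F)\boxtimes-$, $\varepsilon^{F,r}:(F\boxtimes F^{\diamond})\boxtimes-\to\mathrm{Id}$, such that: (I) $(-\boxtimes F^{\diamond},-\boxtimes F,\eta^{F,l},\varepsilon^{F,l})$ is an adjunction (left adjoint first)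 in $\mathcal{S}\text{-Mod}(\mathcal{S},\mathcal{S})$; (II) $(F\boxtimes-,F^{\diamond}\boxtimes-,\eta^{F,r},\varepsilon^{F,r})$ is an adjunction in $\text{Mod-}\mathcal{S}(\mathcal{S},\mathcal{S})$; (III) $\varepsilon^{F,r}_{F}\circ\eta^{F,l}_{F}=\mathrm{id}_{F}$ and $\varepsilon^{F,l}_{F^{\diamond}}\circ\eta^{F,r}_{F^{\diamond}}=\mathrm{id}_{F^{\diamond}}$; (IV) for all $H,K$, $H\boxtimes\eta^{F,r}_{K}=\eta^{F,l}_{H}\boxtimes K$ and $H\boxtimes\varepsilon^{F,r}_{K}=\varepsilon^{F,l}_{H}\boxtimes K$. Then $F^{\diamond}$ is a right dual of $F$ and $F$ a left dual of $F^{\diamond}$. $\mathcal{S}$ is *rigid* if every object has both a left and a right dual. $F^{\diamond\diamond}$ is a right dual of $F^{\diamond}$; ${}^{\diamond}F$ is a left dual of $F$, so there is an adjunction with first entry ${}^{\diamond}F$ and second entry $F$ (its units and counits carry the superscript ${}^{\diamond}F$), and ${}^{\diamond\diamond}F$ is a left dual of ${}^{\diamond}F$. Choices of these adjunctions are fixed. *)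

theory Defs
  imports "HOL-Algebra.Module"
begin

text \<open>
  Vector spaces over a field \<open>K\<close> are modules over \<open>K\<close> in the sense of \<^theory>\<open>HOL-Algebra.Module\<close>;
  the ring multiplication and unit that the record type \<open>module\<close> inherits play no role there.
\<close>

definition linear_maps ::
  "('a, 'r) ring_scheme \<Rightarrow> ('a, 'v) module \<Rightarrow> ('a, 'w) module \<Rightarrow> ('v \<Rightarrow> 'w) set" where
  "linear_maps K V W =
     {h \<in> carrier V \<rightarrow> carrier W.
        (\<forall>x\<in>carrier V. \<forall>y\<in>carrier V. h (x \<oplus>\<^bsub>V\<^esub> y) = h x \<oplus>\<^bsub>W\<^esub> h y) \<and>
        (\<forall>c\<in>carrier K. \<forall>x\<in>carrier V. h (c \<odot>\<^bsub>V\<^esub> x) = c \<odot>\<^bsub>W\<^esub> h x)}"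


section \<open>Linear categories\<close>

text \<open>
  A small linear category consists of a set of objects and a family of hom-spaces. Morphisms are
  always typed by membership in a hom-space, so the hom-spaces need not be disjoint. Composition
  is written in the applicative order.
\<close>

record ('o, 'm, 'a) linear_cat =
  Ob :: "'o set"
  Hom :: "'o \<Rightarrow> 'o \<Rightarrow> ('a, 'm) module"
  ident :: "'o \<Rightarrow> 'm"
  comp_mor :: "'m \<Rightarrow> 'm \<Rightarrow> 'm"  (infixl \<open>\<cdot>\<index>\<close> 55)

abbreviation mor :: "('o, 'm, 'a, 'z) linear_cat_scheme \<Rightarrow> 'o \<Rightarrow> 'o \<Rightarrow> 'm set" where
  "mor C X Y \<equiv> carrier (Hom C X Y)"

locale linear_category =
  fixes K :: "('a, 'r) ring_scheme" and C :: "('o, 'm, 'a, 'z) linear_cat_scheme" (structure)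
  assumes field_K: "field K"
    and Hom_module: "\<lbrakk>X \<in> Ob C; Y \<in> Ob C\<rbrakk> \<Longrightarrow> module K (Hom C X Y)"
    and ident_in_hom: "X \<in> Ob C \<Longrightarrow> ident C X \<in> mor C X X"
    and comp_in_hom:
      "\<lbrakk>X \<in> Ob C; Y \<in> Ob C; Z \<in> Ob C; f \<in> mor C X Y; g \<in> mor C Y Z\<rbrakk> \<Longrightarrow> g \<cdot> f \<in> mor C X Z"
    and ident_left: "\<lbrakk>X \<in> Ob C; Y \<in> Ob C; f \<in> mor C X Y\<rbrakk> \<Longrightarrow> ident C Y \<cdot> f = f"
    and ident_right: "\<lbrakk>X \<in> Ob C; Y \<in> Ob C; f \<in> mor C X Y\<rbrakk> \<Longrightarrow> f \<cdot> ident C X = f"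
    and comp_assoc:
      "\<lbrakk>W \<in> Ob C; X \<in> Ob C; Y \<in> Ob C; Z \<in> Ob C;
        f \<in> mor C W X; g \<in> mor C X Y; h \<in> mor C Y Z\<rbrakk> \<Longrightarrow> (h \<cdot> g) \<cdot> f = h \<cdot> (g \<cdot> f)"
    and comp_linear_right:
      "\<lbrakk>X \<in> Ob C; Y \<in> Ob C; Z \<in> Ob C; g \<in> mor C Y Z\<rbrakk> \<Longrightarrow>
        (\<lambda>f. g \<cdot> f) \<in> linear_maps K (Hom C X Y) (Hom C X Z)"
    and comp_linear_left:
      "\<lbrakk>X \<in> Ob C; Y \<in> Ob C; Z \<in> Ob C; f \<in> mor C X Y\<rbrakk> \<Longrightarrow>
        (\<lambda>g. g \<cdot> f) \<in> linear_maps K (Hom C Y Z) (Hom C X Z)"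

definition inverse_pair ::
  "('o, 'm, 'a, 'z) linear_cat_scheme \<Rightarrow> 'o \<Rightarrow> 'o \<Rightarrow> 'm \<Rightarrow> 'm \<Rightarrow> bool" where
  "inverse_pair C X Y f g \<longleftrightarrow>
     f \<in> mor C X Y \<and> g \<in> mor C Y X \<and> g \<cdot>\<^bsub>C\<^esub> f = ident C X \<and> f \<cdot>\<^bsub>C\<^esub> g = ident C Y"

definition isomorphism :: "('o, 'm, 'a, 'z) linear_cat_scheme \<Rightarrow> 'o \<Rightarrow> 'o \<Rightarrow> 'm \<Rightarrow> bool" where
  "isomorphism C X Y f \<longleftrightarrow> (\<exists>g. inverse_pair C X Y f g)"

definition inverse_mor :: "('o, 'm, 'a, 'z) linear_cat_scheme \<Rightarrow> 'o \<Rightarrow> 'o \<Rightarrow> 'm \<Rightarrow> 'm" where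
  "inverse_mor C X Y f = (THE g. inverse_pair C X Y f g)"


section \<open>Presheaves of vector spaces\<close>

record ('o, 'm, 'a, 'v) presheaf_data =
  ps_space :: "'o \<Rightarrow> ('a, 'v) module"
  ps_map :: "'m \<Rightarrow> 'v \<Rightarrow> 'v"

text \<open>A linear functor from the opposite category of \<open>C\<close> to \<open>K\<close>-vector spaces.\<close>

definition presheaf ::
  "('a, 'r) ring_scheme \<Rightarrow> ('o, 'm, 'a, 'z) linear_cat_scheme \<Rightarrow>
   ('o, 'm, 'a, 'v) presheaf_data \<Rightarrow> bool" where
  "presheaf K C P \<longleftrightarrow>
     (\<forall>X\<in>Ob C. module K (ps_space P X)) \<and>
     (\<forall>X\<in>Ob C. \<forall>Y\<in>Ob C. \<forall>f\<in>mor C X Y.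
        ps_map P f \<in> linear_maps K (ps_space P Y) (ps_space P X)) \<and>
     (\<forall>X\<in>Ob C. \<forall>x\<in>carrier (ps_space P X). ps_map P (ident C X) x = x) \<and>
     (\<forall>X\<in>Ob C. \<forall>Y\<in>Ob C. \<forall>Z\<in>Ob C. \<forall>f\<in>mor C X Y. \<forall>g\<in>mor C Y Z. \<forall>x\<in>carrier (ps_space P Z).
        ps_map P (g \<cdot>\<^bsub>C\<^esub> f) x = ps_map P f (ps_map P g x)) \<and>
     (\<forall>X\<in>Ob C. \<forall>Y\<in>Ob C. \<forall>x\<in>carrier (ps_space P Y).
        (\<lambda>f. ps_map P f x) \<in> linear_maps K (Hom C X Y) (ps_space P X))"

definition presheaf_morphism ::
  "('a, 'r) ring_scheme \<Rightarrow> ('o, 'm, 'a, 'z) linear_cat_scheme \<Rightarrow>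
   ('o, 'm, 'a, 'v) presheaf_data \<Rightarrow> ('o, 'm, 'a, 'w) presheaf_data \<Rightarrow>
   ('o \<Rightarrow> 'v \<Rightarrow> 'w) \<Rightarrow> bool" where
  "presheaf_morphism K C P Q \<theta> \<longleftrightarrow>
     presheaf K C P \<and> presheaf K C Q \<and>
     (\<forall>X\<in>Ob C. \<theta> X \<in> linear_maps K (ps_space P X) (ps_space Q X)) \<and>
     (\<forall>X\<in>Ob C. \<forall>Y\<in>Ob C. \<forall>f\<in>mor C X Y. \<forall>x\<in>carrier (ps_space P Y).
        \<theta> X (ps_map P f x) = ps_map Q f (\<theta> Y x))"

definition mutually_inverse_presheaf_isos ::
  "('a, 'r) ring_scheme \<Rightarrow> ('o, 'm, 'a, 'z) linear_cat_scheme \<Rightarrow>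
   ('o, 'm, 'a, 'v) presheaf_data \<Rightarrow> ('o, 'm, 'a, 'w) presheaf_data \<Rightarrow>
   ('o \<Rightarrow> 'v \<Rightarrow> 'w) \<Rightarrow> ('o \<Rightarrow> 'w \<Rightarrow> 'v) \<Rightarrow> bool" where
  "mutually_inverse_presheaf_isos K C P Q \<theta> \<theta>' \<longleftrightarrow>
     presheaf_morphism K C P Q \<theta> \<and> presheaf_morphism K C Q P \<theta>' \<and>
     (\<forall>X\<in>Ob C. \<forall>x\<in>carrier (ps_space P X). \<theta>' X (\<theta> X x) = x) \<and>
     (\<forall>X\<in>Ob C. \<forall>y\<in>carrier (ps_space Q X). \<theta> X (\<theta>' X y) = y)"


section \<open>Semigroup categories\<close>

record ('o, 'm, 'a) semigroup_cat = "('o, 'm, 'a) linear_cat" +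
  tensor :: "'o \<Rightarrow> 'o \<Rightarrow> 'o"  (infixr \<open>\<boxtimes>\<index>\<close> 65)
  tensor_mor :: "'m \<Rightarrow> 'm \<Rightarrow> 'm"  (infixr \<open>\<star>\<index>\<close> 60)
  associator :: "'o \<Rightarrow> 'o \<Rightarrow> 'o \<Rightarrow> 'm"

abbreviation whisker_left ::
  "('o, 'm, 'a, 'z) semigroup_cat_scheme \<Rightarrow> 'o \<Rightarrow> 'm \<Rightarrow> 'm"  (\<open>_ \<triangleright>\<index> _\<close> [61, 60] 60) where
  "X \<triangleright>\<^bsub>C\<^esub> f \<equiv> ident C X \<star>\<^bsub>C\<^esub> f"

abbreviation whisker_right ::
  "('o, 'm, 'a, 'z) semigroup_cat_scheme \<Rightarrow> 'm \<Rightarrow> 'o \<Rightarrow> 'm"  (\<open>_ \<triangleleft>\<index> _\<close> [60, 61] 60) where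
  "f \<triangleleft>\<^bsub>C\<^esub> X \<equiv> f \<star>\<^bsub>C\<^esub> ident C X"

locale semigroup_category =
  linear_category K C
  for K :: "('a, 'r) ring_scheme" and C :: "('o, 'm, 'a, 'z) semigroup_cat_scheme" (structure) +
  assumes tensor_Ob: "\<lbrakk>X \<in> Ob C; Y \<in> Ob C\<rbrakk> \<Longrightarrow> X \<boxtimes> Y \<in> Ob C"
    and tensor_in_hom:
      "\<lbrakk>X \<in> Ob C; X' \<in> Ob C; Y \<in> Ob C; Y' \<in> Ob C; f \<in> mor C X X'; g \<in> mor C Y Y'\<rbrakk> \<Longrightarrow>
        f \<star> g \<in> mor C (X \<boxtimes> Y) (X' \<boxtimes> Y')"
    and tensor_ident: "\<lbrakk>X \<in> Ob C; Y \<in> Ob C\<rbrakk> \<Longrightarrow> ident C X \<star> ident C Y = ident C (X \<boxtimes> Y)"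
    and tensor_comp:
      "\<lbrakk>X \<in> Ob C; X' \<in> Ob C; X'' \<in> Ob C; Y \<in> Ob C; Y' \<in> Ob C; Y'' \<in> Ob C;
        f \<in> mor C X X'; f' \<in> mor C X' X''; g \<in> mor C Y Y'; g' \<in> mor C Y' Y''\<rbrakk> \<Longrightarrow>
        (f' \<cdot> f) \<star> (g' \<cdot> g) = (f' \<star> g') \<cdot> (f \<star> g)"
    and tensor_linear_right:
      "\<lbrakk>X \<in> Ob C; X' \<in> Ob C; Y \<in> Ob C; Y' \<in> Ob C; f \<in> mor C X X'\<rbrakk> \<Longrightarrow>
        (\<lambda>g. f \<star> g) \<in> linear_maps K (Hom C Y Y') (Hom C (X \<boxtimes> Y) (X' \<boxtimes> Y'))"
    and tensor_linear_left:
      "\<lbrakk>X \<in> Ob C; X' \<in> Ob C; Y \<in> Ob C; Y' \<in> Ob C; g \<in> mor C Y Y'\<rbrakk> \<Longrightarrow>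
        (\<lambda>f. f \<star> g) \<in> linear_maps K (Hom C X X') (Hom C (X \<boxtimes> Y) (X' \<boxtimes> Y'))"
    and assoc_iso:
      "\<lbrakk>X \<in> Ob C; Y \<in> Ob C; Z \<in> Ob C\<rbrakk> \<Longrightarrow>
        isomorphism C ((X \<boxtimes> Y) \<boxtimes> Z) (X \<boxtimes> (Y \<boxtimes> Z)) (associator C X Y Z)"
    and assoc_natural:
      "\<lbrakk>X \<in> Ob C; X' \<in> Ob C; Y \<in> Ob C; Y' \<in> Ob C; Z \<in> Ob C; Z' \<in> Ob C;
        f \<in> mor C X X'; g \<in> mor C Y Y'; h \<in> mor C Z Z'\<rbrakk> \<Longrightarrow>
        associator C X' Y' Z' \<cdot> ((f \<star> g) \<star> h) = (f \<star> (g \<star> h)) \<cdot> associator C X Y Z"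
    and pentagon:
      "\<lbrakk>W \<in> Ob C; X \<in> Ob C; Y \<in> Ob C; Z \<in> Ob C\<rbrakk> \<Longrightarrow>
        associator C W X (Y \<boxtimes> Z) \<cdot> associator C (W \<boxtimes> X) Y Z =
        (W \<triangleright> associator C X Y Z) \<cdot> associator C W (X \<boxtimes> Y) Z \<cdot> (associator C W X Y \<triangleleft> Z)"

definition associator_inv :: "('o, 'm, 'a, 'z) semigroup_cat_scheme \<Rightarrow> 'o \<Rightarrow> 'o \<Rightarrow> 'o \<Rightarrow> 'm" where
  "associator_inv C X Y Z =
     inverse_mor C ((X \<boxtimes>\<^bsub>C\<^esub> Y) \<boxtimes>\<^bsub>C\<^esub> Z) (X \<boxtimes>\<^bsub>C\<^esub> (Y \<boxtimes>\<^bsub>C\<^esub> Z)) (associator C X Y Z)"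


section \<open>Module endofunctors and their transformations\<close>

text \<open>
  The component \<open>ef_str G X Y\<close> is the structure isomorphism: \<open>G (X \<boxtimes> Y) \<rightarrow> X \<boxtimes> G Y\<close> for a left
  module endofunctor, and \<open>G (X \<boxtimes> Y) \<rightarrow> G X \<boxtimes> Y\<close> for a right one.
\<close>

record ('o, 'm) endofunctor =
  ef_ob :: "'o \<Rightarrow> 'o"
  ef_mor :: "'m \<Rightarrow> 'm"
  ef_str :: "'o \<Rightarrow> 'o \<Rightarrow> 'm"

definition linear_endofunctor ::
  "('a, 'r) ring_scheme \<Rightarrow> ('o, 'm, 'a, 'z) linear_cat_scheme \<Rightarrow> ('o, 'm) endofunctor \<Rightarrow> bool" where
  "linear_endofunctor K C G \<longleftrightarrow>
     (\<forall>X\<in>Ob C. ef_ob G X \<in> Ob C) \<and>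
     (\<forall>X\<in>Ob C. \<forall>Y\<in>Ob C.
        ef_mor G \<in> linear_maps K (Hom C X Y) (Hom C (ef_ob G X) (ef_ob G Y))) \<and>
     (\<forall>X\<in>Ob C. ef_mor G (ident C X) = ident C (ef_ob G X)) \<and>
     (\<forall>X\<in>Ob C. \<forall>Y\<in>Ob C. \<forall>Z\<in>Ob C. \<forall>f\<in>mor C X Y. \<forall>g\<in>mor C Y Z.
        ef_mor G (g \<cdot>\<^bsub>C\<^esub> f) = ef_mor G g \<cdot>\<^bsub>C\<^esub> ef_mor G f)"

definition left_module_endofunctor ::
  "('a, 'r) ring_scheme \<Rightarrow> ('o, 'm, 'a, 'z) semigroup_cat_scheme \<Rightarrow> ('o, 'm) endofunctor \<Rightarrow> bool"
  where
  "left_module_endofunctor K C G \<longleftrightarrow>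
     linear_endofunctor K C G \<and>
     (\<forall>X\<in>Ob C. \<forall>Y\<in>Ob C.
        isomorphism C (ef_ob G (X \<boxtimes>\<^bsub>C\<^esub> Y)) (X \<boxtimes>\<^bsub>C\<^esub> ef_ob G Y) (ef_str G X Y)) \<and>
     (\<forall>X\<in>Ob C. \<forall>X'\<in>Ob C. \<forall>Y\<in>Ob C. \<forall>Y'\<in>Ob C. \<forall>f\<in>mor C X X'. \<forall>g\<in>mor C Y Y'.
        ef_str G X' Y' \<cdot>\<^bsub>C\<^esub> ef_mor G (f \<star>\<^bsub>C\<^esub> g) = (f \<star>\<^bsub>C\<^esub> ef_mor G g) \<cdot>\<^bsub>C\<^esub> ef_str G X Y) \<and>
     (\<forall>X\<in>Ob C. \<forall>Y\<in>Ob C. \<forall>Z\<in>Ob C.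
        associator C X Y (ef_ob G Z) \<cdot>\<^bsub>C\<^esub> ef_str G (X \<boxtimes>\<^bsub>C\<^esub> Y) Z =
        (X \<triangleright>\<^bsub>C\<^esub> ef_str G Y Z) \<cdot>\<^bsub>C\<^esub> ef_str G X (Y \<boxtimes>\<^bsub>C\<^esub> Z) \<cdot>\<^bsub>C\<^esub> ef_mor G (associator C X Y Z))"

definition right_module_endofunctor ::
  "('a, 'r) ring_scheme \<Rightarrow> ('o, 'm, 'a, 'z) semigroup_cat_scheme \<Rightarrow> ('o, 'm) endofunctor \<Rightarrow> bool"
  where
  "right_module_endofunctor K C G \<longleftrightarrow>
     linear_endofunctor K C G \<and>
     (\<forall>X\<in>Ob C. \<forall>Y\<in>Ob C.
        isomorphism C (ef_ob G (X \<boxtimes>\<^bsub>C\<^esub> Y)) (ef_ob G X \<boxtimes>\<^bsub>C\<^esub> Y) (ef_str G X Y)) \<and>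
     (\<forall>X\<in>Ob C. \<forall>X'\<in>Ob C. \<forall>Y\<in>Ob C. \<forall>Y'\<in>Ob C. \<forall>f\<in>mor C X X'. \<forall>g\<in>mor C Y Y'.
        ef_str G X' Y' \<cdot>\<^bsub>C\<^esub> ef_mor G (f \<star>\<^bsub>C\<^esub> g) = (ef_mor G f \<star>\<^bsub>C\<^esub> g) \<cdot>\<^bsub>C\<^esub> ef_str G X Y) \<and>
     (\<forall>X\<in>Ob C. \<forall>Y\<in>Ob C. \<forall>Z\<in>Ob C.
        associator C (ef_ob G X) Y Z \<cdot>\<^bsub>C\<^esub> (ef_str G X Y \<triangleleft>\<^bsub>C\<^esub> Z) \<cdot>\<^bsub>C\<^esub> ef_str G (X \<boxtimes>\<^bsub>C\<^esub> Y) Z =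
        ef_str G X (Y \<boxtimes>\<^bsub>C\<^esub> Z) \<cdot>\<^bsub>C\<^esub> ef_mor G (associator C X Y Z))"

text \<open>
  Transformations are extensional on \<open>Ob C\<close>, so that their equality is equality of all components.
\<close>

definition nat_transf ::
  "('o, 'm, 'a, 'z) linear_cat_scheme \<Rightarrow> ('o, 'm) endofunctor \<Rightarrow> ('o, 'm) endofunctor \<Rightarrow>
   ('o \<Rightarrow> 'm) set" where
  "nat_transf C G G' =
     {\<alpha> \<in> (\<Pi>\<^sub>E X\<in>Ob C. mor C (ef_ob G X) (ef_ob G' X)).
        \<forall>X\<in>Ob C. \<forall>Y\<in>Ob C. \<forall>f\<in>mor C X Y. \<alpha> Y \<cdot>\<^bsub>C\<^esub> ef_mor G f = ef_mor G' f \<cdot>\<^bsub>C\<^esub> \<alpha> X}"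

definition left_module_transf ::
  "('o, 'm, 'a, 'z) semigroup_cat_scheme \<Rightarrow> ('o, 'm) endofunctor \<Rightarrow> ('o, 'm) endofunctor \<Rightarrow>
   ('o \<Rightarrow> 'm) set" where
  "left_module_transf C G G' =
     {\<alpha> \<in> nat_transf C G G'. \<forall>X\<in>Ob C. \<forall>Y\<in>Ob C.
        ef_str G' X Y \<cdot>\<^bsub>C\<^esub> \<alpha> (X \<boxtimes>\<^bsub>C\<^esub> Y) = (X \<triangleright>\<^bsub>C\<^esub> \<alpha> Y) \<cdot>\<^bsub>C\<^esub> ef_str G X Y}"

definition right_module_transf ::
  "('o, 'm, 'a, 'z) semigroup_cat_scheme \<Rightarrow> ('o, 'm) endofunctor \<Rightarrow> ('o, 'm) endofunctor \<Rightarrow>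
   ('o \<Rightarrow> 'm) set" where
  "right_module_transf C G G' =
     {\<alpha> \<in> nat_transf C G G'. \<forall>X\<in>Ob C. \<forall>Y\<in>Ob C.
        ef_str G' X Y \<cdot>\<^bsub>C\<^esub> \<alpha> (X \<boxtimes>\<^bsub>C\<^esub> Y) = (\<alpha> X \<triangleleft>\<^bsub>C\<^esub> Y) \<cdot>\<^bsub>C\<^esub> ef_str G X Y}"

text \<open>The componentwise vector space structure on a set \<open>T\<close> of transformations from \<open>G\<close> to \<open>G'\<close>.\<close>

definition transf_space ::
  "('o, 'm, 'a, 'z) linear_cat_scheme \<Rightarrow> ('o, 'm) endofunctor \<Rightarrow> ('o, 'm) endofunctor \<Rightarrow>
   ('o \<Rightarrow> 'm) set \<Rightarrow> ('a, 'o \<Rightarrow> 'm) module" where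
  "transf_space C G G' T =
     \<lparr>carrier = T,
      mult = undefined,
      one = undefined,
      zero = (\<lambda>X\<in>Ob C. \<zero>\<^bsub>Hom C (ef_ob G X) (ef_ob G' X)\<^esub>),
      add = (\<lambda>\<alpha> \<beta>. \<lambda>X\<in>Ob C. \<alpha> X \<oplus>\<^bsub>Hom C (ef_ob G X) (ef_ob G' X)\<^esub> \<beta> X),
      smult = (\<lambda>c \<alpha>. \<lambda>X\<in>Ob C. c \<odot>\<^bsub>Hom C (ef_ob G X) (ef_ob G' X)\<^esub> \<alpha> X)\<rparr>"

definition left_module_Hom ::
  "('o, 'm, 'a, 'z) semigroup_cat_scheme \<Rightarrow> ('o, 'm) endofunctor \<Rightarrow> ('o, 'm) endofunctor \<Rightarrow>
   ('a, 'o \<Rightarrow> 'm) module" where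
  "left_module_Hom C G G' = transf_space C G G' (left_module_transf C G G')"

definition right_module_Hom ::
  "('o, 'm, 'a, 'z) semigroup_cat_scheme \<Rightarrow> ('o, 'm) endofunctor \<Rightarrow> ('o, 'm) endofunctor \<Rightarrow>
   ('a, 'o \<Rightarrow> 'm) module" where
  "right_module_Hom C G G' = transf_space C G G' (right_module_transf C G G')"

definition Id_functor :: "('o, 'm, 'a, 'z) semigroup_cat_scheme \<Rightarrow> ('o, 'm) endofunctor" where
  "Id_functor C =
     \<lparr>ef_ob = (\<lambda>X. X), ef_mor = (\<lambda>f. f), ef_str = (\<lambda>X Y. ident C (X \<boxtimes>\<^bsub>C\<^esub> Y))\<rparr>"

text \<open>The left module endofunctor \<open>- \<boxtimes> F\<close> and the right module endofunctor \<open>F \<boxtimes> -\<close>.\<close>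

definition tensor_by_right ::
  "('o, 'm, 'a, 'z) semigroup_cat_scheme \<Rightarrow> 'o \<Rightarrow> ('o, 'm) endofunctor" where
  "tensor_by_right C F =
     \<lparr>ef_ob = (\<lambda>X. X \<boxtimes>\<^bsub>C\<^esub> F), ef_mor = (\<lambda>f. f \<triangleleft>\<^bsub>C\<^esub> F), ef_str = (\<lambda>X Y. associator C X Y F)\<rparr>"

definition tensor_by_left ::
  "('o, 'm, 'a, 'z) semigroup_cat_scheme \<Rightarrow> 'o \<Rightarrow> ('o, 'm) endofunctor" where
  "tensor_by_left C F =
     \<lparr>ef_ob = (\<lambda>X. F \<boxtimes>\<^bsub>C\<^esub> X), ef_mor = (\<lambda>f. F \<triangleright>\<^bsub>C\<^esub> f), ef_str = (\<lambda>X Y. associator_inv C F X Y)\<rparr>"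

text \<open>Composites \<open>G \<circ> G'\<close> of left, respectively right, module endofunctors.\<close>

definition left_module_comp ::
  "('o, 'm, 'a, 'z) semigroup_cat_scheme \<Rightarrow> ('o, 'm) endofunctor \<Rightarrow> ('o, 'm) endofunctor \<Rightarrow>
   ('o, 'm) endofunctor" where
  "left_module_comp C G G' =
     \<lparr>ef_ob = (\<lambda>X. ef_ob G (ef_ob G' X)),
      ef_mor = (\<lambda>f. ef_mor G (ef_mor G' f)),
      ef_str = (\<lambda>X Y. ef_str G X (ef_ob G' Y) \<cdot>\<^bsub>C\<^esub> ef_mor G (ef_str G' X Y))\<rparr>"

definition right_module_comp ::
  "('o, 'm, 'a, 'z) semigroup_cat_scheme \<Rightarrow> ('o, 'm) endofunctor \<Rightarrow> ('o, 'm) endofunctor \<Rightarrow>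
   ('o, 'm) endofunctor" where
  "right_module_comp C G G' =
     \<lparr>ef_ob = (\<lambda>X. ef_ob G (ef_ob G' X)),
      ef_mor = (\<lambda>f. ef_mor G (ef_mor G' f)),
      ef_str = (\<lambda>X Y. ef_str G (ef_ob G' X) Y \<cdot>\<^bsub>C\<^esub> ef_mor G (ef_str G' X Y))\<rparr>"

definition triangle_identities ::
  "('o, 'm, 'a, 'z) linear_cat_scheme \<Rightarrow> ('o, 'm) endofunctor \<Rightarrow> ('o, 'm) endofunctor \<Rightarrow>
   ('o \<Rightarrow> 'm) \<Rightarrow> ('o \<Rightarrow> 'm) \<Rightarrow> bool" where
  "triangle_identities C L R \<eta> \<epsilon> \<longleftrightarrow>
     (\<forall>X\<in>Ob C. \<epsilon> (ef_ob L X) \<cdot>\<^bsub>C\<^esub> ef_mor L (\<eta> X) = ident C (ef_ob L X)) \<and>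
     (\<forall>X\<in>Ob C. ef_mor R (\<epsilon> X) \<cdot>\<^bsub>C\<^esub> \<eta> (ef_ob R X) = ident C (ef_ob R X))"

text \<open>Here \<open>L\<close> is the left adjoint.\<close>

definition left_module_adjunction ::
  "('a, 'r) ring_scheme \<Rightarrow> ('o, 'm, 'a, 'z) semigroup_cat_scheme \<Rightarrow>
   ('o, 'm) endofunctor \<Rightarrow> ('o, 'm) endofunctor \<Rightarrow> ('o \<Rightarrow> 'm) \<Rightarrow> ('o \<Rightarrow> 'm) \<Rightarrow> bool" where
  "left_module_adjunction K C L R \<eta> \<epsilon> \<longleftrightarrow>
     left_module_endofunctor K C L \<and> left_module_endofunctor K C R \<and>
     \<eta> \<in> left_module_transf C (Id_functor C) (left_module_comp C R L) \<and>
     \<epsilon> \<in> left_module_transf C (left_module_comp C L R) (Id_functor C) \<and>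
     triangle_identities C L R \<eta> \<epsilon>"

definition right_module_adjunction ::
  "('a, 'r) ring_scheme \<Rightarrow> ('o, 'm, 'a, 'z) semigroup_cat_scheme \<Rightarrow>
   ('o, 'm) endofunctor \<Rightarrow> ('o, 'm) endofunctor \<Rightarrow> ('o \<Rightarrow> 'm) \<Rightarrow> ('o \<Rightarrow> 'm) \<Rightarrow> bool" where
  "right_module_adjunction K C L R \<eta> \<epsilon> \<longleftrightarrow>
     right_module_endofunctor K C L \<and> right_module_endofunctor K C R \<and>
     \<eta> \<in> right_module_transf C (Id_functor C) (right_module_comp C R L) \<and>
     \<epsilon> \<in> right_module_transf C (right_module_comp C L R) (Id_functor C) \<and>
     triangle_identities C L R \<eta> \<epsilon>"


section \<open>Adjunctions in a semigroup category and rigidity\<close>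

text \<open>
  For an adjunction \<open>A\<close>, the object \<open>adj_snd A\<close> is a right dual of \<open>adj_fst A\<close>.
\<close>

record ('o, 'm) adjunction_data =
  adj_fst :: 'o
  adj_snd :: 'o
  unit_l :: "'o \<Rightarrow> 'm"
  unit_r :: "'o \<Rightarrow> 'm"
  counit_l :: "'o \<Rightarrow> 'm"
  counit_r :: "'o \<Rightarrow> 'm"

text \<open>
  The associators that are customarily suppressed are written out. For instance, with
  \<open>G = adj_snd A\<close>, the unit \<open>Id \<rightarrow> - \<boxtimes> (G \<boxtimes> F)\<close> becomes the unit \<open>Id \<rightarrow> (- \<boxtimes> G) \<boxtimes> F\<close> of an
  adjunction of functors only after composing with the inverse associator.
\<close>

definition adjunction ::
  "('a, 'r) ring_scheme \<Rightarrow> ('o, 'm, 'a, 'z) semigroup_cat_scheme \<Rightarrow>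
   ('o, 'm) adjunction_data \<Rightarrow> bool" where
  "adjunction K C A \<longleftrightarrow>
    (let F = adj_fst A; G = adj_snd A;
         \<eta>l = unit_l A; \<eta>r = unit_r A; \<epsilon>l = counit_l A; \<epsilon>r = counit_r A
     in
       F \<in> Ob C \<and> G \<in> Ob C \<and>
       \<eta>l \<in> left_module_transf C (Id_functor C) (tensor_by_right C (G \<boxtimes>\<^bsub>C\<^esub> F)) \<and>
       \<epsilon>l \<in> left_module_transf C (tensor_by_right C (F \<boxtimes>\<^bsub>C\<^esub> G)) (Id_functor C) \<and>
       \<eta>r \<in> right_module_transf C (Id_functor C) (tensor_by_left C (G \<boxtimes>\<^bsub>C\<^esub> F)) \<and>
       \<epsilon>r \<in> right_module_transf C (tensor_by_left C (F \<boxtimes>\<^bsub>C\<^esub> G)) (Id_functor C) \<and>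
       left_module_adjunction K C (tensor_by_right C G) (tensor_by_right C F)
         (\<lambda>H\<in>Ob C. associator_inv C H G F \<cdot>\<^bsub>C\<^esub> \<eta>l H)
         (\<lambda>H\<in>Ob C. \<epsilon>l H \<cdot>\<^bsub>C\<^esub> associator C H F G) \<and>
       right_module_adjunction K C (tensor_by_left C F) (tensor_by_left C G)
         (\<lambda>H\<in>Ob C. associator C G F H \<cdot>\<^bsub>C\<^esub> \<eta>r H)
         (\<lambda>H\<in>Ob C. \<epsilon>r H \<cdot>\<^bsub>C\<^esub> associator_inv C F G H) \<and>
       \<epsilon>r F \<cdot>\<^bsub>C\<^esub> associator_inv C F G F \<cdot>\<^bsub>C\<^esub> \<eta>l F = ident C F \<and>
       \<epsilon>l G \<cdot>\<^bsub>C\<^esub> associator C G F G \<cdot>\<^bsub>C\<^esub> \<eta>r G = ident C G \<and>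
       (\<forall>H\<in>Ob C. \<forall>L\<in>Ob C.
          H \<triangleright>\<^bsub>C\<^esub> \<eta>r L = associator C H (G \<boxtimes>\<^bsub>C\<^esub> F) L \<cdot>\<^bsub>C\<^esub> (\<eta>l H \<triangleleft>\<^bsub>C\<^esub> L)) \<and>
       (\<forall>H\<in>Ob C. \<forall>L\<in>Ob C.
          (H \<triangleright>\<^bsub>C\<^esub> \<epsilon>r L) \<cdot>\<^bsub>C\<^esub> associator C H (F \<boxtimes>\<^bsub>C\<^esub> G) L = \<epsilon>l H \<triangleleft>\<^bsub>C\<^esub> L))"

definition rigid ::
  "('a, 'r) ring_scheme \<Rightarrow> ('o, 'm, 'a, 'z) semigroup_cat_scheme \<Rightarrow> bool" where
  "rigid K C \<longleftrightarrow>
     (\<forall>F\<in>Ob C. (\<exists>A. adjunction K C A \<and> adj_fst A = F) \<and> (\<exists>A. adjunction K C A \<and> adj_snd A = F))"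

text \<open>
  A choice of duals: \<open>rad F\<close> is an adjunction exhibiting a right dual of \<open>F\<close>, and \<open>lad F\<close> is one
  exhibiting a left dual of \<open>F\<close>. The two choices are independent of each other.
\<close>

definition right_dual_choice ::
  "('a, 'r) ring_scheme \<Rightarrow> ('o, 'm, 'a, 'z) semigroup_cat_scheme \<Rightarrow>
   ('o \<Rightarrow> ('o, 'm) adjunction_data) \<Rightarrow> bool" where
  "right_dual_choice K C rad \<longleftrightarrow> (\<forall>F\<in>Ob C. adjunction K C (rad F) \<and> adj_fst (rad F) = F)"

definition left_dual_choice ::
  "('a, 'r) ring_scheme \<Rightarrow> ('o, 'm, 'a, 'z) semigroup_cat_scheme \<Rightarrow>
   ('o \<Rightarrow> ('o, 'm) adjunction_data) \<Rightarrow> bool" where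
  "left_dual_choice K C lad \<longleftrightarrow> (\<forall>F\<in>Ob C. adjunction K C (lad F) \<and> adj_snd (lad F) = F)"


section \<open>The two presheaves and the maps between them\<close>

text \<open>\<open>F \<mapsto> Hom (F \<boxtimes> -, Id)\<close> in right module endofunctors; \<open>f\<close> acts by precomposition with \<open>f \<boxtimes> -\<close>.\<close>

definition right_Hom_presheaf ::
  "('o, 'm, 'a, 'z) semigroup_cat_scheme \<Rightarrow> ('o, 'm, 'a, 'o \<Rightarrow> 'm) presheaf_data" where
  "right_Hom_presheaf C =
     \<lparr>ps_space = (\<lambda>F. right_module_Hom C (tensor_by_left C F) (Id_functor C)),
      ps_map = (\<lambda>f \<alpha>. \<lambda>H\<in>Ob C. \<alpha> H \<cdot>\<^bsub>C\<^esub> (f \<triangleleft>\<^bsub>C\<^esub> H))\<rparr>"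

text \<open>\<open>F \<mapsto> Hom (- \<boxtimes> F, Id)\<close> in left module endofunctors; \<open>f\<close> acts by precomposition with \<open>- \<boxtimes> f\<close>.\<close>

definition left_Hom_presheaf ::
  "('o, 'm, 'a, 'z) semigroup_cat_scheme \<Rightarrow> ('o, 'm, 'a, 'o \<Rightarrow> 'm) presheaf_data" where
  "left_Hom_presheaf C =
     \<lparr>ps_space = (\<lambda>F. left_module_Hom C (tensor_by_right C F) (Id_functor C)),
      ps_map = (\<lambda>f \<beta>. \<lambda>H\<in>Ob C. \<beta> H \<cdot>\<^bsub>C\<^esub> (H \<triangleright>\<^bsub>C\<^esub> f))\<rparr>"

text \<open>
  In \<open>Psi\<close>, the objects \<open>G\<close> and \<open>G2\<close> are the chosen right dual of \<open>F\<close> and its chosen right dual.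
  The composite, with its last factor applied first, runs through
  \<open>HF \<rightarrow> (HF)(GF) \<rightarrow> ((HF)(GF))(G2 G) \<rightarrow> (((HF)(GF))G2)G \<rightarrow> ((((HF)G)F)G2)G \<rightarrow> (((HF)G)(F G2))G
   \<rightarrow> (((HF)G)G2)G \<rightarrow> ((HF)(G G2))G \<rightarrow> (HF)G \<rightarrow> H(FG) \<rightarrow> H\<close>.
\<close>

definition Psi ::
  "('o, 'm, 'a, 'z) semigroup_cat_scheme \<Rightarrow> ('o \<Rightarrow> ('o, 'm) adjunction_data) \<Rightarrow>
   'o \<Rightarrow> ('o \<Rightarrow> 'm) \<Rightarrow> ('o \<Rightarrow> 'm)" where
  "Psi C rad F \<alpha> =
    (let G = adj_snd (rad F); G2 = adj_snd (rad G)
     in (\<lambda>H\<in>Ob C.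
       counit_l (rad F) H \<cdot>\<^bsub>C\<^esub>
       associator C H F G \<cdot>\<^bsub>C\<^esub>
       (counit_l (rad G) (H \<boxtimes>\<^bsub>C\<^esub> F) \<triangleleft>\<^bsub>C\<^esub> G) \<cdot>\<^bsub>C\<^esub>
       (associator C (H \<boxtimes>\<^bsub>C\<^esub> F) G G2 \<triangleleft>\<^bsub>C\<^esub> G) \<cdot>\<^bsub>C\<^esub>
       ((((H \<boxtimes>\<^bsub>C\<^esub> F) \<boxtimes>\<^bsub>C\<^esub> G) \<triangleright>\<^bsub>C\<^esub> \<alpha> G2) \<triangleleft>\<^bsub>C\<^esub> G) \<cdot>\<^bsub>C\<^esub>
       (associator C ((H \<boxtimes>\<^bsub>C\<^esub> F) \<boxtimes>\<^bsub>C\<^esub> G) F G2 \<triangleleft>\<^bsub>C\<^esub> G) \<cdot>\<^bsub>C\<^esub>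
       ((associator_inv C (H \<boxtimes>\<^bsub>C\<^esub> F) G F \<triangleleft>\<^bsub>C\<^esub> G2) \<triangleleft>\<^bsub>C\<^esub> G) \<cdot>\<^bsub>C\<^esub>
       associator_inv C ((H \<boxtimes>\<^bsub>C\<^esub> F) \<boxtimes>\<^bsub>C\<^esub> (G \<boxtimes>\<^bsub>C\<^esub> F)) G2 G \<cdot>\<^bsub>C\<^esub>
       unit_l (rad G) ((H \<boxtimes>\<^bsub>C\<^esub> F) \<boxtimes>\<^bsub>C\<^esub> (G \<boxtimes>\<^bsub>C\<^esub> F)) \<cdot>\<^bsub>C\<^esub>
       unit_l (rad F) (H \<boxtimes>\<^bsub>C\<^esub> F)))"

text \<open>
  In \<open>Phi\<close>, the objects \<open>D\<close> and \<open>D2\<close> are the chosen left dual of \<open>F\<close> and its chosen left dual.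
  The composite, with its last factor applied first, runs through
  \<open>FH \<rightarrow> (FD)(FH) \<rightarrow> (D D2)((FD)(FH)) \<rightarrow> D(D2((FD)(FH))) \<rightarrow> D(D2(F(D(FH)))) \<rightarrow> D((D2 F)(D(FH)))
   \<rightarrow> D(D2(D(FH))) \<rightarrow> D((D2 D)(FH)) \<rightarrow> D(FH) \<rightarrow> (DF)H \<rightarrow> H\<close>.
\<close>

definition Phi ::
  "('o, 'm, 'a, 'z) semigroup_cat_scheme \<Rightarrow> ('o \<Rightarrow> ('o, 'm) adjunction_data) \<Rightarrow>
   'o \<Rightarrow> ('o \<Rightarrow> 'm) \<Rightarrow> ('o \<Rightarrow> 'm)" where
  "Phi C lad F \<beta> =
    (let D = adj_fst (lad F); D2 = adj_fst (lad D)
     in (\<lambda>H\<in>Ob C.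
       counit_r (lad F) H \<cdot>\<^bsub>C\<^esub>
       associator_inv C D F H \<cdot>\<^bsub>C\<^esub>
       (D \<triangleright>\<^bsub>C\<^esub> counit_r (lad D) (F \<boxtimes>\<^bsub>C\<^esub> H)) \<cdot>\<^bsub>C\<^esub>
       (D \<triangleright>\<^bsub>C\<^esub> associator_inv C D2 D (F \<boxtimes>\<^bsub>C\<^esub> H)) \<cdot>\<^bsub>C\<^esub>
       (D \<triangleright>\<^bsub>C\<^esub> (\<beta> D2 \<triangleleft>\<^bsub>C\<^esub> (D \<boxtimes>\<^bsub>C\<^esub> (F \<boxtimes>\<^bsub>C\<^esub> H)))) \<cdot>\<^bsub>C\<^esub>
       (D \<triangleright>\<^bsub>C\<^esub> associator_inv C D2 F (D \<boxtimes>\<^bsub>C\<^esub> (F \<boxtimes>\<^bsub>C\<^esub> H))) \<cdot>\<^bsub>C\<^esub>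
       (D \<triangleright>\<^bsub>C\<^esub> (D2 \<triangleright>\<^bsub>C\<^esub> associator C F D (F \<boxtimes>\<^bsub>C\<^esub> H))) \<cdot>\<^bsub>C\<^esub>
       associator C D D2 ((F \<boxtimes>\<^bsub>C\<^esub> D) \<boxtimes>\<^bsub>C\<^esub> (F \<boxtimes>\<^bsub>C\<^esub> H)) \<cdot>\<^bsub>C\<^esub>
       unit_r (lad D) ((F \<boxtimes>\<^bsub>C\<^esub> D) \<boxtimes>\<^bsub>C\<^esub> (F \<boxtimes>\<^bsub>C\<^esub> H)) \<cdot>\<^bsub>C\<^esub>
       unit_r (lad F) (F \<boxtimes>\<^bsub>C\<^esub> H)))"

end

theory Submission
  imports Defs
begin

text \<open>
  Call \<open>\<alpha> : F \<boxtimes> - \<rightarrow> Id\<close> and \<open>\<beta> : - \<boxtimes> F \<rightarrow> Id\<close> balanced if \<open>X \<boxtimes> \<alpha> Y = \<beta> X \<boxtimes> Y\<close> for all \<open>X\<close>, \<open>Y\<close>, the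
  condition that axiom (IV) imposes on units and counits. By (IV), tensoring \<open>\<Psi>(\<alpha>)\<close> with \<open>Y\<close> on
  the right moves all units and counits to the other side, where naturality and the triangle
  identities of (II) collapse the composite to \<open>\<alpha> Y\<close>; hence \<open>\<alpha>\<close> and \<open>\<Psi>(\<alpha>)\<close> are balanced.
  By (III), the unit at an object that has a right dual is a split monomorphism, so the functors
  \<open>- \<boxtimes> Y\<close> are jointly faithful. Therefore \<open>\<Psi>(\<alpha>)\<close> is the only partner of \<open>\<alpha>\<close>, which makes it
  a module transformation, linear and natural in \<open>\<alpha>\<close>. Reversing the tensor product exchanges
  left and right duals and turns \<open>\<Psi>\<close> into \<open>\<Phi>\<close>, so \<open>\<Phi>(\<beta>)\<close> is the only partner of \<open>\<beta>\<close>, and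
  the two maps are inverse to each other.
\<close>

section \<open>Arrows with endpoints\<close>

text \<open>
  A morphism does not determine its endpoints. Carrying them along lets the simplifier compute the
  intermediate objects in the typing conditions of composites.
\<close>

datatype ('o, 'm) arrow = Arrow (src: 'o) (body: 'm) (tgt: 'o)

text \<open>Two-sided inverses are unique, so the definite description in \<open>inverse_mor\<close>
  can be evaluated as soon as one inverse is known.\<close>

lemma (in linear_category) inverse_mor_eq:
  assumes "inverse_pair C X Y f g" and ob: "X \<in> Ob C" "Y \<in> Ob C"
  shows "inverse_mor C X Y f = g"
  unfolding inverse_mor_def
proof (rule the_equality)
  fix h assume "inverse_pair C X Y f h"
  then have h: "h \<in> mor C Y X" "h \<cdot> f = ident C X" and g: "g \<in> mor C Y X" "f \<cdot> g = ident C Y"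
    and f: "f \<in> mor C X Y"
    using assms(1) by (auto simp: inverse_pair_def)
  have "h = h \<cdot> (f \<cdot> g)"
    using g(2) ident_right[OF ob(2,1) h(1)] by simp
  also have "\<dots> = (h \<cdot> f) \<cdot> g"
    by (rule comp_assoc[OF ob(2,1,2,1) g(1) f h(1), symmetric])
  also have "\<dots> = g"
    using h(2) ident_left[OF ob(2,1) g(1)] by simp
  finally show "h = g" .
qed (fact assms(1))

context semigroup_category
begin

definition arr :: "('o, 'm) arrow \<Rightarrow> bool" where
  "arr f \<longleftrightarrow> src f \<in> Ob C \<and> tgt f \<in> Ob C \<and> body f \<in> mor C (src f) (tgt f)"

definition idn :: "'o \<Rightarrow> ('o, 'm) arrow" where
  "idn X = Arrow X (ident C X) X"

definition cmp :: "('o, 'm) arrow \<Rightarrow> ('o, 'm) arrow \<Rightarrow> ('o, 'm) arrow"  (infixr \<open>\<bullet>\<close> 55) where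
  "g \<bullet> f = Arrow (src f) (body g \<cdot> body f) (tgt g)"

definition lwh :: "'o \<Rightarrow> ('o, 'm) arrow \<Rightarrow> ('o, 'm) arrow"  (infixr \<open>\<unrhd>\<close> 60) where
  "X \<unrhd> f = Arrow (X \<boxtimes> src f) (X \<triangleright> body f) (X \<boxtimes> tgt f)"

definition rwh :: "('o, 'm) arrow \<Rightarrow> 'o \<Rightarrow> ('o, 'm) arrow"  (infixl \<open>\<unlhd>\<close> 61) where
  "f \<unlhd> X = Arrow (src f \<boxtimes> X) (body f \<triangleleft> X) (tgt f \<boxtimes> X)"

definition asc :: "'o \<Rightarrow> 'o \<Rightarrow> 'o \<Rightarrow> ('o, 'm) arrow" where
  "asc X Y Z = Arrow ((X \<boxtimes> Y) \<boxtimes> Z) (associator C X Y Z) (X \<boxtimes> (Y \<boxtimes> Z))"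

definition asi :: "'o \<Rightarrow> 'o \<Rightarrow> 'o \<Rightarrow> ('o, 'm) arrow" where
  "asi X Y Z = Arrow (X \<boxtimes> (Y \<boxtimes> Z)) (associator_inv C X Y Z) ((X \<boxtimes> Y) \<boxtimes> Z)"

lemma arr_Arrow: "arr (Arrow X f Y) \<longleftrightarrow> X \<in> Ob C \<and> Y \<in> Ob C \<and> f \<in> mor C X Y"
  by (simp add: arr_def)

lemma src_tgt [simp]:
  "src (idn X) = X" "tgt (idn X) = X"
  "src (g \<bullet> f) = src f" "tgt (g \<bullet> f) = tgt g"
  "src (X \<unrhd> f) = X \<boxtimes> src f" "tgt (X \<unrhd> f) = X \<boxtimes> tgt f"
  "src (f \<unlhd> X) = src f \<boxtimes> X" "tgt (f \<unlhd> X) = tgt f \<boxtimes> X"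
  "src (asc X Y Z) = (X \<boxtimes> Y) \<boxtimes> Z" "tgt (asc X Y Z) = X \<boxtimes> (Y \<boxtimes> Z)"
  "src (asi X Y Z) = X \<boxtimes> (Y \<boxtimes> Z)" "tgt (asi X Y Z) = (X \<boxtimes> Y) \<boxtimes> Z"
  by (simp_all add: idn_def cmp_def lwh_def rwh_def asc_def asi_def)

lemma tensor_Ob_simp [simp]: "X \<in> Ob C \<Longrightarrow> Y \<in> Ob C \<Longrightarrow> X \<boxtimes> Y \<in> Ob C"
  by (rule tensor_Ob)

lemma associator_inverse_pair:
  assumes "X \<in> Ob C" "Y \<in> Ob C" "Z \<in> Ob C"
  shows "inverse_pair C ((X \<boxtimes> Y) \<boxtimes> Z) (X \<boxtimes> (Y \<boxtimes> Z)) (associator C X Y Z) (associator_inv C X Y Z)"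
  using assoc_iso[OF assms] assms
  by (auto simp: isomorphism_def associator_inv_def inverse_mor_eq)

lemma arr_idn [simp]: "X \<in> Ob C \<Longrightarrow> arr (idn X)"
  by (simp add: arr_def ident_in_hom idn_def)

lemma arr_cmp [simp]: "arr f \<Longrightarrow> arr g \<Longrightarrow> tgt f = src g \<Longrightarrow> arr (g \<bullet> f)"
  using comp_in_hom[of "src f" "tgt f" "tgt g" "body f" "body g"] by (simp add: arr_def cmp_def)

lemma arr_lwh [simp]: "X \<in> Ob C \<Longrightarrow> arr f \<Longrightarrow> arr (X \<unrhd> f)"
  using tensor_in_hom[of X X "src f" "tgt f" "ident C X" "body f"]
  by (simp add: arr_def lwh_def ident_in_hom)

lemma arr_rwh [simp]: "X \<in> Ob C \<Longrightarrow> arr f \<Longrightarrow> arr (f \<unlhd> X)"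
  using tensor_in_hom[of "src f" "tgt f" X X "body f" "ident C X"]
  by (simp add: arr_def rwh_def ident_in_hom)

lemma arr_asc [simp]: "X \<in> Ob C \<Longrightarrow> Y \<in> Ob C \<Longrightarrow> Z \<in> Ob C \<Longrightarrow> arr (asc X Y Z)"
  and arr_asi [simp]: "X \<in> Ob C \<Longrightarrow> Y \<in> Ob C \<Longrightarrow> Z \<in> Ob C \<Longrightarrow> arr (asi X Y Z)"
  using associator_inverse_pair[of X Y Z] by (auto simp: arr_def asc_def asi_def inverse_pair_def)

text \<open>As a simp rule this nests all composites to the right, the normal form on which the
  later rewriting relies.\<close>

lemma cmp_assoc [simp]:
  "\<lbrakk>arr f; arr g; arr h; tgt f = src g; tgt g = src h\<rbrakk> \<Longrightarrow> (h \<bullet> g) \<bullet> f = h \<bullet> (g \<bullet> f)"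
  by (simp add: arr_def cmp_def comp_assoc[of "src f" "tgt f" "tgt g" "tgt h"])

text \<open>The premise \<open>X = tgt f\<close>, in place of a pattern \<open>idn (tgt f)\<close>,
  lets the rule fire after the endpoint has been simplified to another term; several rules below use
  the same device.\<close>

lemma cmp_idn_left [simp]: "arr f \<Longrightarrow> X = tgt f \<Longrightarrow> idn X \<bullet> f = f"
  using ident_left[of "src f" "tgt f" "body f"] by (cases f) (simp add: arr_def cmp_def idn_def)

lemma cmp_idn_right [simp]: "arr f \<Longrightarrow> X = src f \<Longrightarrow> f \<bullet> idn X = f"
  using ident_right[of "src f" "tgt f" "body f"] by (cases f) (simp add: arr_def cmp_def idn_def)

lemma lwh_idn [simp]: "X \<in> Ob C \<Longrightarrow> Y \<in> Ob C \<Longrightarrow> X \<unrhd> idn Y = idn (X \<boxtimes> Y)"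
  and rwh_idn [simp]: "X \<in> Ob C \<Longrightarrow> Y \<in> Ob C \<Longrightarrow> idn X \<unlhd> Y = idn (X \<boxtimes> Y)"
  by (simp_all add: lwh_def rwh_def idn_def tensor_ident)

lemma lwh_cmp:
  "\<lbrakk>X \<in> Ob C; arr f; arr g; tgt f = src g\<rbrakk> \<Longrightarrow> X \<unrhd> (g \<bullet> f) = (X \<unrhd> g) \<bullet> (X \<unrhd> f)"
  using tensor_comp[of X X X "src f" "tgt f" "tgt g" "ident C X" "ident C X" "body f" "body g"]
    ident_left[of X X "ident C X"]
  by (simp add: arr_def cmp_def lwh_def ident_in_hom)

lemma rwh_cmp:
  "\<lbrakk>X \<in> Ob C; arr f; arr g; tgt f = src g\<rbrakk> \<Longrightarrow> (g \<bullet> f) \<unlhd> X = (g \<unlhd> X) \<bullet> (f \<unlhd> X)"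
  using tensor_comp[of "src f" "tgt f" "tgt g" X X X "body f" "body g" "ident C X" "ident C X"]
    ident_left[of X X "ident C X"]
  by (simp add: arr_def cmp_def rwh_def ident_in_hom)

text \<open>By \<open>tensor_comp\<close> and the unit laws both sides have the body
  \<open>body f \<star> body g\<close>.\<close>

lemma whisker_exchange:
  assumes "arr f" "arr g" "X = src f" "X' = tgt f" "Y = src g" "Y' = tgt g"
  shows "(X' \<unrhd> g) \<bullet> (f \<unlhd> Y) = (f \<unlhd> Y') \<bullet> (X \<unrhd> g)"
  using assms
    tensor_comp[of "src f" "tgt f" "tgt f" "src g" "src g" "tgt g" "body f" "ident C (tgt f)"
      "ident C (src g)" "body g"]
    tensor_comp[of "src f" "src f" "tgt f" "src g" "tgt g" "tgt g" "ident C (src f)" "body f"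
      "body g" "ident C (tgt g)"]
    ident_left[of "src f" "tgt f" "body f"] ident_right[of "src f" "tgt f" "body f"]
    ident_left[of "src g" "tgt g" "body g"] ident_right[of "src g" "tgt g" "body g"]
  by (simp add: arr_def cmp_def lwh_def rwh_def ident_in_hom)

section \<open>Calculus of associators and their inverses\<close>

lemma asc_asi [simp]:
  "\<lbrakk>X \<in> Ob C; Y \<in> Ob C; Z \<in> Ob C\<rbrakk> \<Longrightarrow> asc X Y Z \<bullet> asi X Y Z = idn (X \<boxtimes> (Y \<boxtimes> Z))"
  and asi_asc [simp]:
  "\<lbrakk>X \<in> Ob C; Y \<in> Ob C; Z \<in> Ob C\<rbrakk> \<Longrightarrow> asi X Y Z \<bullet> asc X Y Z = idn ((X \<boxtimes> Y) \<boxtimes> Z)"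
  using associator_inverse_pair[of X Y Z]
  by (auto simp: asc_def asi_def cmp_def idn_def inverse_pair_def)

text \<open>Composites are built from whiskered arrows, so naturality of the associator is needed
  with two identities: one rule for each position of the remaining arrow.\<close>

lemma asc_natural_left:
  "\<lbrakk>arr f; Y \<in> Ob C; Z \<in> Ob C; X' = tgt f\<rbrakk> \<Longrightarrow>
    asc X' Y Z \<bullet> (f \<unlhd> Y \<unlhd> Z) = (f \<unlhd> (Y \<boxtimes> Z)) \<bullet> asc (src f) Y Z"
  using assoc_natural[of "src f" "tgt f" Y Y Z Z "body f" "ident C Y" "ident C Z"]
  by (simp add: arr_def asc_def cmp_def rwh_def ident_in_hom tensor_ident)

lemma asc_natural_mid:
  "\<lbrakk>arr f; X \<in> Ob C; Z \<in> Ob C; Y' = tgt f\<rbrakk> \<Longrightarrow>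
    asc X Y' Z \<bullet> ((X \<unrhd> f) \<unlhd> Z) = (X \<unrhd> (f \<unlhd> Z)) \<bullet> asc X (src f) Z"
  using assoc_natural[of X X "src f" "tgt f" Z Z "ident C X" "body f" "ident C Z"]
  by (simp add: arr_def asc_def cmp_def rwh_def lwh_def ident_in_hom)

lemma asc_natural_right:
  "\<lbrakk>arr f; X \<in> Ob C; Y \<in> Ob C; Z' = tgt f\<rbrakk> \<Longrightarrow>
    asc X Y Z' \<bullet> ((X \<boxtimes> Y) \<unrhd> f) = (X \<unrhd> (Y \<unrhd> f)) \<bullet> asc X Y (src f)"
  using assoc_natural[of X X Y Y "src f" "tgt f" "ident C X" "ident C Y" "body f"]
  by (simp add: arr_def asc_def cmp_def lwh_def ident_in_hom tensor_ident)

lemma asc_pentagon: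
  "\<lbrakk>W \<in> Ob C; X \<in> Ob C; Y \<in> Ob C; Z \<in> Ob C\<rbrakk> \<Longrightarrow>
    (W \<unrhd> asc X Y Z) \<bullet> asc W (X \<boxtimes> Y) Z \<bullet> (asc W X Y \<unlhd> Z) =
    asc W X (Y \<boxtimes> Z) \<bullet> asc (W \<boxtimes> X) Y Z"
  \<comment> \<open>The axiom \<open>pentagon\<close> brackets its triple composite to the left,
    while \<open>\<bullet>\<close> associates to the right; this instance of
    \<open>cmp_assoc\<close> mediates.\<close>
  using pentagon[of W X Y Z] cmp_assoc[of "asc W X Y \<unlhd> Z" "asc W (X \<boxtimes> Y) Z" "W \<unrhd> asc X Y Z"]
  by (simp del: cmp_assoc) (simp add: asc_def cmp_def lwh_def rwh_def)

lemma src_Ob [simp]: "arr f \<Longrightarrow> src f \<in> Ob C" and tgt_Ob [simp]: "arr f \<Longrightarrow> tgt f \<in> Ob C"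
  by (simp_all add: arr_def)

text \<open>In right-nested form \<open>g \<bullet> f\<close> is not a subterm of
  \<open>g \<bullet> f \<bullet> x\<close>. This extends an equation for
  \<open>g \<bullet> f\<close> so that it also rewrites in front of a tail \<open>x\<close>.\<close>

lemma cmp_reassoc:
  "\<lbrakk>g \<bullet> f = k; arr f; arr g; tgt f = src g; arr x; tgt x = src f\<rbrakk> \<Longrightarrow> g \<bullet> f \<bullet> x = k \<bullet> x"
  using cmp_assoc[of x f g] by simp

text \<open>The pentagon with associators moved across as inverses. This form and its two variants
  below have only two factors on the left, which makes them usable for rewriting inside long
  composites.\<close>

lemma asc_lwh_pentagon:
  assumes [simp]: "W \<in> Ob C" "X \<in> Ob C" "Y \<in> Ob C" "Z \<in> Ob C"
  shows "asc W (X \<boxtimes> Y) Z \<bullet> (asc W X Y \<unlhd> Z) =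
    (W \<unrhd> asi X Y Z) \<bullet> asc W X (Y \<boxtimes> Z) \<bullet> asc (W \<boxtimes> X) Y Z"
proof -
  have "(W \<unrhd> asi X Y Z) \<bullet> (W \<unrhd> asc X Y Z) = idn (W \<boxtimes> ((X \<boxtimes> Y) \<boxtimes> Z))"
    by (simp add: lwh_cmp[symmetric])
  note cmp_reassoc[OF this]
  then show ?thesis
    by (simp add: asc_pentagon[symmetric])
qed

lemma asc_rwh_inv_pentagon:
  assumes [simp]: "W \<in> Ob C" "X \<in> Ob C" "Y \<in> Ob C" "Z \<in> Ob C"
  shows "asc (W \<boxtimes> X) Y Z \<bullet> (asi W X Y \<unlhd> Z) =
    asi W X (Y \<boxtimes> Z) \<bullet> (W \<unrhd> asc X Y Z) \<bullet> asc W (X \<boxtimes> Y) Z"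
proof -
  have c: "(asc W X Y \<unlhd> Z) \<bullet> (asi W X Y \<unlhd> Z) = idn ((W \<boxtimes> (X \<boxtimes> Y)) \<boxtimes> Z)"
    by (simp add: rwh_cmp[symmetric])
  \<comment> \<open>Composing the pentagon with \<open>asi W X (Y \<boxtimes> Z)\<close> isolates
    \<open>asc (W \<boxtimes> X) Y Z\<close>; the whiskered associator on the right end is then
    cancelled by its inverse.\<close>
  have "asi W X (Y \<boxtimes> Z) \<bullet> ((W \<unrhd> asc X Y Z) \<bullet> asc W (X \<boxtimes> Y) Z \<bullet> (asc W X Y \<unlhd> Z)) =
    asc (W \<boxtimes> X) Y Z"
    by (simp add: asc_pentagon cmp_reassoc[OF asi_asc])
  then have "asc (W \<boxtimes> X) Y Z \<bullet> (asi W X Y \<unlhd> Z) =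
     (asi W X (Y \<boxtimes> Z) \<bullet> ((W \<unrhd> asc X Y Z) \<bullet> asc W (X \<boxtimes> Y) Z \<bullet> (asc W X Y \<unlhd> Z))) \<bullet> (asi W X Y \<unlhd> Z)"
    by (simp del: cmp_assoc)
  also have "\<dots> = asi W X (Y \<boxtimes> Z) \<bullet> (W \<unrhd> asc X Y Z) \<bullet> asc W (X \<boxtimes> Y) Z"
    by (simp add: c)
  finally show ?thesis .
qed


text \<open>Obtained from \<open>asc_natural_mid\<close> by composing with inverse associators on
  both sides.\<close>

lemma asi_natural_mid:
  assumes [simp]: "arr f" "X \<in> Ob C" "Z \<in> Ob C" and Y: "Y = src f"
  shows "(X \<unrhd> f) \<unlhd> Z \<bullet> asi X Y Z = asi X (tgt f) Z \<bullet> X \<unrhd> (f \<unlhd> Z)"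
proof -
  have "(X \<unrhd> f) \<unlhd> Z \<bullet> asi X Y Z =
      asi X (tgt f) Z \<bullet> (asc X (tgt f) Z \<bullet> (X \<unrhd> f) \<unlhd> Z) \<bullet> asi X Y Z"
    by (simp add: Y cmp_reassoc[OF asi_asc])
  also have "\<dots> = asi X (tgt f) Z \<bullet> X \<unrhd> (f \<unlhd> Z)"
    by (simp add: Y asc_natural_mid)
  finally show ?thesis .
qed

lemma asi_natural_right:
  assumes [simp]: "arr f" "X \<in> Ob C" "Y \<in> Ob C"
  shows "asi X Y (tgt f) \<bullet> X \<unrhd> Y \<unrhd> f = (X \<boxtimes> Y) \<unrhd> f \<bullet> asi X Y (src f)"
proof -
  have "asi X Y (tgt f) \<bullet> X \<unrhd> Y \<unrhd> f =
      asi X Y (tgt f) \<bullet> (X \<unrhd> Y \<unrhd> f \<bullet> asc X Y (src f)) \<bullet> asi X Y (src f)"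
    by simp
  also have "\<dots> = (X \<boxtimes> Y) \<unrhd> f \<bullet> asi X Y (src f)"
    by (simp add: asc_natural_right[symmetric] cmp_reassoc[OF asi_asc])
  finally show ?thesis .
qed

lemma asc_asi_pentagon:
  assumes [simp]: "W \<in> Ob C" "X \<in> Ob C" "Y \<in> Ob C" "Z \<in> Ob C"
  shows "asc W X Y \<unlhd> Z \<bullet> asi (W \<boxtimes> X) Y Z =
    asi W (X \<boxtimes> Y) Z \<bullet> W \<unrhd> asi X Y Z \<bullet> asc W X (Y \<boxtimes> Z)"
proof -
  have "asc W X Y \<unlhd> Z \<bullet> asi (W \<boxtimes> X) Y Z =
      asi W (X \<boxtimes> Y) Z \<bullet> (asc W (X \<boxtimes> Y) Z \<bullet> asc W X Y \<unlhd> Z) \<bullet> asi (W \<boxtimes> X) Y Z"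
    by (simp add: cmp_reassoc[OF asi_asc])
  also have "\<dots> = asi W (X \<boxtimes> Y) Z \<bullet> W \<unrhd> asi X Y Z \<bullet> asc W X (Y \<boxtimes> Z)"
    by (simp add: asc_lwh_pentagon)
  finally show ?thesis .
qed

section \<open>Dual pairs\<close>

definition unl :: "('o, 'm) adjunction_data \<Rightarrow> 'o \<Rightarrow> ('o, 'm) arrow" where
  "unl A X = Arrow X (unit_l A X) (X \<boxtimes> (adj_snd A \<boxtimes> adj_fst A))"

definition unr :: "('o, 'm) adjunction_data \<Rightarrow> 'o \<Rightarrow> ('o, 'm) arrow" where
  "unr A X = Arrow X (unit_r A X) ((adj_snd A \<boxtimes> adj_fst A) \<boxtimes> X)"

definition cnl :: "('o, 'm) adjunction_data \<Rightarrow> 'o \<Rightarrow> ('o, 'm) arrow" where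
  "cnl A X = Arrow (X \<boxtimes> (adj_fst A \<boxtimes> adj_snd A)) (counit_l A X) X"

definition cnr :: "('o, 'm) adjunction_data \<Rightarrow> 'o \<Rightarrow> ('o, 'm) arrow" where
  "cnr A X = Arrow ((adj_fst A \<boxtimes> adj_snd A) \<boxtimes> X) (counit_r A X) X"

lemma src_tgt_unit [simp]:
  "src (unl A X) = X" "tgt (unl A X) = X \<boxtimes> (adj_snd A \<boxtimes> adj_fst A)"
  "src (unr A X) = X" "tgt (unr A X) = (adj_snd A \<boxtimes> adj_fst A) \<boxtimes> X"
  "src (cnl A X) = X \<boxtimes> (adj_fst A \<boxtimes> adj_snd A)" "tgt (cnl A X) = X"
  "src (cnr A X) = (adj_fst A \<boxtimes> adj_snd A) \<boxtimes> X" "tgt (cnr A X) = X"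
  by (simp_all add: unl_def unr_def cnl_def cnr_def)

text \<open>The consequences of \<^const>\<open>adjunction\<close> that the proof uses; this part is stable under reversal.\<close>

definition dual_pair :: "('o, 'm) adjunction_data \<Rightarrow> bool" where
  "dual_pair A \<longleftrightarrow> (let F = adj_fst A; G = adj_snd A in
     F \<in> Ob C \<and> G \<in> Ob C \<and>
     (\<forall>X\<in>Ob C. arr (unl A X) \<and> arr (unr A X) \<and> arr (cnl A X) \<and> arr (cnr A X)) \<and>
     (\<forall>f. arr f \<longrightarrow>
        unl A (tgt f) \<bullet> f = f \<unlhd> (G \<boxtimes> F) \<bullet> unl A (src f) \<and>
        unr A (tgt f) \<bullet> f = (G \<boxtimes> F) \<unrhd> f \<bullet> unr A (src f) \<and>
        cnl A (tgt f) \<bullet> f \<unlhd> (F \<boxtimes> G) = f \<bullet> cnl A (src f) \<and>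
        cnr A (tgt f) \<bullet> (F \<boxtimes> G) \<unrhd> f = f \<bullet> cnr A (src f)) \<and>
     (\<forall>X\<in>Ob C.
        cnr A (F \<boxtimes> X) \<bullet> asi F G (F \<boxtimes> X) \<bullet> F \<unrhd> (asc G F X \<bullet> unr A X) = idn (F \<boxtimes> X) \<and>
        cnl A (X \<boxtimes> G) \<bullet> asc (X \<boxtimes> G) F G \<bullet> (asi X G F \<bullet> unl A X) \<unlhd> G = idn (X \<boxtimes> G)) \<and>
     cnr A F \<bullet> asi F G F \<bullet> unl A F = idn F \<and>
     cnl A G \<bullet> asc G F G \<bullet> unr A G = idn G \<and>
     (\<forall>X\<in>Ob C. \<forall>Y\<in>Ob C.
        X \<unrhd> unr A Y = asc X (G \<boxtimes> F) Y \<bullet> unl A X \<unlhd> Y \<and>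
        X \<unrhd> cnr A Y \<bullet> asc X (F \<boxtimes> G) Y = cnl A X \<unlhd> Y))"

lemma dual_pairD:
  assumes "dual_pair A"
  defines "F \<equiv> adj_fst A" and "G \<equiv> adj_snd A"
  shows "F \<in> Ob C" "G \<in> Ob C"
    and "X \<in> Ob C \<Longrightarrow> arr (unl A X)" "X \<in> Ob C \<Longrightarrow> arr (unr A X)"
      "X \<in> Ob C \<Longrightarrow> arr (cnl A X)" "X \<in> Ob C \<Longrightarrow> arr (cnr A X)"
    and dual_pair_unl_natural: "arr f \<Longrightarrow> unl A (tgt f) \<bullet> f = f \<unlhd> (G \<boxtimes> F) \<bullet> unl A (src f)"
    and dual_pair_cnr_natural: "arr f \<Longrightarrow> cnr A (tgt f) \<bullet> (F \<boxtimes> G) \<unrhd> f = f \<bullet> cnr A (src f)"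
    and dual_pair_triangle: "X \<in> Ob C \<Longrightarrow>
      cnr A (F \<boxtimes> X) \<bullet> asi F G (F \<boxtimes> X) \<bullet> F \<unrhd> (asc G F X \<bullet> unr A X) = idn (F \<boxtimes> X)"
    and dual_pair_retraction: "cnr A F \<bullet> asi F G F \<bullet> unl A F = idn F"
    and dual_pair_unit_balance: "X \<in> Ob C \<Longrightarrow> Y \<in> Ob C \<Longrightarrow>
      asc X (G \<boxtimes> F) Y \<bullet> unl A X \<unlhd> Y = X \<unrhd> unr A Y"
    and dual_pair_counit_balance: "X \<in> Ob C \<Longrightarrow> Y \<in> Ob C \<Longrightarrow>
      cnl A X \<unlhd> Y = X \<unrhd> cnr A Y \<bullet> asc X (F \<boxtimes> G) Y"
  using assms by (auto simp: dual_pair_def Let_def)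

text \<open>For the adjunction between \<open>F \<boxtimes> -\<close> and
  \<open>G \<boxtimes> -\<close>, the inner composite is the mate of \<open>f\<close>, and
  transposing it back returns \<open>f\<close>: naturality of the counit pulls \<open>f\<close> to
  the front and leaves a triangle identity.\<close>

lemma dual_pair_mate:
  assumes A: "dual_pair A" and F: "F = adj_fst A" and G: "G = adj_snd A"
    and X [simp]: "X \<in> Ob C" and f: "arr f" "src f = F \<boxtimes> X" and Y: "tgt f = Y"
  shows "cnr A Y \<bullet> asi F G Y \<bullet> F \<unrhd> (G \<unrhd> f \<bullet> asc G F X \<bullet> unr A X) = f"
proof -
  note [simp] = dual_pairD(1-6)[OF A, folded F G] F[symmetric] G[symmetric] f Y[symmetric]
  have "cnr A Y \<bullet> asi F G Y \<bullet> F \<unrhd> (G \<unrhd> f \<bullet> asc G F X \<bullet> unr A X) =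
      cnr A Y \<bullet> (asi F G Y \<bullet> F \<unrhd> G \<unrhd> f) \<bullet> F \<unrhd> (asc G F X \<bullet> unr A X)"
    by (simp add: lwh_cmp)
  also have "\<dots> = (cnr A Y \<bullet> (F \<boxtimes> G) \<unrhd> f) \<bullet> asi F G (F \<boxtimes> X) \<bullet> F \<unrhd> (asc G F X \<bullet> unr A X)"
    using asi_natural_right[of f F G] by simp
  also have "\<dots> = f"
    using dual_pair_cnr_natural[OF A, of f] dual_pair_triangle[OF A, of X] by simp
  finally show ?thesis .
qed

text \<open>Merging whiskers under one \<open>F \<unrhd>\<close> hides the triangle identity in a
  longer composite. This form, with \<open>f\<close> before the unit and a tail \<open>g\<close>, is
  the one met in \<open>balanced_Psi\<close>.\<close>

lemma dual_pair_triangle_cmp: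
  assumes A: "dual_pair A" and F: "F = adj_fst A" and G: "G = adj_snd A"
    and f: "arr f" "tgt f = X" and g: "arr g" "tgt g = F \<boxtimes> src f"
  shows "cnr A (F \<boxtimes> X) \<bullet> asi F G (F \<boxtimes> X) \<bullet> F \<unrhd> (asc G F X \<bullet> unr A X \<bullet> f) \<bullet> g = F \<unrhd> f \<bullet> g"
proof -
  note [simp] = dual_pairD(1-6)[OF A, folded F G] F[symmetric] G[symmetric] f(1) f(2)[symmetric] g
  have "cnr A (F \<boxtimes> X) \<bullet> asi F G (F \<boxtimes> X) \<bullet> F \<unrhd> (asc G F X \<bullet> unr A X \<bullet> f) \<bullet> g =
      (cnr A (F \<boxtimes> X) \<bullet> asi F G (F \<boxtimes> X) \<bullet> F \<unrhd> (asc G F X \<bullet> unr A X)) \<bullet> F \<unrhd> f \<bullet> g"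
    by (simp add: lwh_cmp)
  also have "\<dots> = F \<unrhd> f \<bullet> g"
    using dual_pair_triangle[OF A, of X] by simp
  finally show ?thesis .
qed

text \<open>By naturality of the unit and its retraction from (III), an arrow \<open>h\<close> into
  \<open>F\<close> is recovered from \<open>h \<unlhd> (G \<boxtimes> F)\<close> and the unit at
  \<open>src h\<close>.\<close>

lemma joint_faithful:
  assumes A: "dual_pair A" and f: "arr f" and g: "arr g"
    and fg: "src f = src g" "tgt f = adj_fst A" "tgt g = adj_fst A"
    and eq: "\<And>X. X \<in> Ob C \<Longrightarrow> f \<unlhd> X = g \<unlhd> X"
  shows "f = g"
proof -
  define F G where "F = adj_fst A" "G = adj_snd A"
  note [simp] = dual_pairD(1-6)[OF A, folded F_G_def] F_G_def[symmetric] f g fg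
  have "h = cnr A F \<bullet> asi F G F \<bullet> h \<unlhd> (G \<boxtimes> F) \<bullet> unl A (src h)"
    if [simp]: "arr h" "tgt h = F" for h
  proof -
    have "h = (cnr A F \<bullet> asi F G F \<bullet> unl A F) \<bullet> h"
      using dual_pair_retraction[OF A] by simp
    also have "\<dots> = cnr A F \<bullet> asi F G F \<bullet> h \<unlhd> (G \<boxtimes> F) \<bullet> unl A (src h)"
      using dual_pair_unl_natural[OF A, of h] by simp
    finally show ?thesis .
  qed
  from this[of f] this[of g] show ?thesis
    by (simp add: eq)
qed

section \<open>Balanced pairs of transformations\<close>

definition nar :: "'o \<Rightarrow> ('o \<Rightarrow> 'm) \<Rightarrow> 'o \<Rightarrow> ('o, 'm) arrow" where
  "nar F \<alpha> X = Arrow (F \<boxtimes> X) (\<alpha> X) X"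

definition nal :: "'o \<Rightarrow> ('o \<Rightarrow> 'm) \<Rightarrow> 'o \<Rightarrow> ('o, 'm) arrow" where
  "nal F \<beta> X = Arrow (X \<boxtimes> F) (\<beta> X) X"

lemma src_tgt_nat [simp]:
  "src (nar F \<alpha> X) = F \<boxtimes> X" "tgt (nar F \<alpha> X) = X"
  "src (nal F \<beta> X) = X \<boxtimes> F" "tgt (nal F \<beta> X) = X"
  by (simp_all add: nar_def nal_def)

abbreviation Right_Hom :: "'o \<Rightarrow> ('o \<Rightarrow> 'm) set" where
  "Right_Hom F \<equiv> right_module_transf C (tensor_by_left C F) (Id_functor C)"

abbreviation Left_Hom :: "'o \<Rightarrow> ('o \<Rightarrow> 'm) set" where
  "Left_Hom F \<equiv> left_module_transf C (tensor_by_right C F) (Id_functor C)"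

lemma all_arr_iff: "(\<forall>f. arr f \<longrightarrow> P f) \<longleftrightarrow> (\<forall>X\<in>Ob C. \<forall>Y\<in>Ob C. \<forall>f\<in>mor C X Y. P (Arrow X f Y))"
  by (metis arrow.collapse arr_Arrow)

text \<open>\<open>asi\<close> appears because the structure map of \<open>F \<boxtimes> -\<close>
  runs from \<open>F \<boxtimes> (X \<boxtimes> Y)\<close> to
  \<open>(F \<boxtimes> X) \<boxtimes> Y\<close>; the one of \<open>Id_functor\<close> is an
  identity and drops out.\<close>

lemma Right_Hom_iff:
  assumes [simp]: "F \<in> Ob C"
  shows "\<alpha> \<in> Right_Hom F \<longleftrightarrow>
    \<alpha> \<in> extensional (Ob C) \<and> (\<forall>X\<in>Ob C. arr (nar F \<alpha> X)) \<and>
    (\<forall>f. arr f \<longrightarrow> nar F \<alpha> (tgt f) \<bullet> F \<unrhd> f = f \<bullet> nar F \<alpha> (src f)) \<and>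
    (\<forall>X\<in>Ob C. \<forall>Y\<in>Ob C. nar F \<alpha> (X \<boxtimes> Y) = nar F \<alpha> X \<unlhd> Y \<bullet> asi F X Y)"
proof -
  have "ident C (X \<boxtimes> Y) \<cdot> \<alpha> (X \<boxtimes> Y) = \<alpha> (X \<boxtimes> Y)"
    if "X \<in> Ob C" "Y \<in> Ob C" "\<forall>X\<in>Ob C. \<alpha> X \<in> mor C (F \<boxtimes> X) X" for X Y
    using that ident_left[of "F \<boxtimes> (X \<boxtimes> Y)" "X \<boxtimes> Y" "\<alpha> (X \<boxtimes> Y)"] by simp
  then show ?thesis
    by (auto simp: right_module_transf_def nat_transf_def tensor_by_left_def Id_functor_def all_arr_iff
        arr_Arrow nar_def cmp_def lwh_def rwh_def asi_def PiE_iff)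
qed

lemma Left_Hom_iff:
  assumes [simp]: "F \<in> Ob C"
  shows "\<beta> \<in> Left_Hom F \<longleftrightarrow>
    \<beta> \<in> extensional (Ob C) \<and> (\<forall>X\<in>Ob C. arr (nal F \<beta> X)) \<and>
    (\<forall>f. arr f \<longrightarrow> nal F \<beta> (tgt f) \<bullet> f \<unlhd> F = f \<bullet> nal F \<beta> (src f)) \<and>
    (\<forall>X\<in>Ob C. \<forall>Y\<in>Ob C. nal F \<beta> (X \<boxtimes> Y) = X \<unrhd> nal F \<beta> Y \<bullet> asc X Y F)"
proof -
  have "ident C (X \<boxtimes> Y) \<cdot> \<beta> (X \<boxtimes> Y) = \<beta> (X \<boxtimes> Y)"
    if "X \<in> Ob C" "Y \<in> Ob C" "\<forall>X\<in>Ob C. \<beta> X \<in> mor C (X \<boxtimes> F) X" for X Y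
    using that ident_left[of "(X \<boxtimes> Y) \<boxtimes> F" "X \<boxtimes> Y" "\<beta> (X \<boxtimes> Y)"] by simp
  then show ?thesis
    by (auto simp: left_module_transf_def nat_transf_def tensor_by_right_def Id_functor_def all_arr_iff
        arr_Arrow nal_def cmp_def lwh_def rwh_def asc_def PiE_iff)
qed

section \<open>Existence and uniqueness of balanced partners\<close>

definition balanced :: "'o \<Rightarrow> ('o \<Rightarrow> 'm) \<Rightarrow> ('o \<Rightarrow> 'm) \<Rightarrow> bool" where
  "balanced F \<alpha> \<beta> \<longleftrightarrow>
    (\<forall>X\<in>Ob C. \<forall>Y\<in>Ob C. X \<unrhd> nar F \<alpha> Y \<bullet> asc X F Y = nal F \<beta> X \<unlhd> Y)"

text \<open>Whiskered with \<open>K\<close>, the composite becomes \<open>H\<close> tensored with a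
  composite of right-hand units and counits. Up to associators, \<alpha> at \<open>G2\<close>
  whiskered by \<open>G\<close> and \<open>K\<close> is \<alpha> at
  \<open>G2 \<boxtimes> (G \<boxtimes> K)\<close>, and naturality moves it past the unit of
  \<open>rad G\<close>. The triangle identity of \<open>rad G\<close> cancels that unit, and what
  remains is \<alpha> at \<open>K\<close>, rebuilt from its mate under \<open>rad F\<close>.\<close>

lemma balanced_Psi:
  assumes rad: "\<And>F. F \<in> Ob C \<Longrightarrow> dual_pair (rad F) \<and> adj_fst (rad F) = F"
    and F [simp]: "F \<in> Ob C" and \<alpha>: "\<alpha> \<in> Right_Hom F"
  shows "balanced F \<alpha> (Psi C rad F \<alpha>)" and "X \<in> Ob C \<Longrightarrow> arr (nal F (Psi C rad F \<alpha>) X)"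
proof -
  define G where "G = adj_snd (rad F)"
  define G2 where "G2 = adj_snd (rad G)"
  have dF: "dual_pair (rad F)" and [simp]: "adj_fst (rad F) = F" "adj_snd (rad F) = G"
    using rad[OF F] by (simp_all add: G_def)
  note F_facts [simp] = dual_pairD(2-6)[OF dF, simplified]
  have dG: "dual_pair (rad G)" and [simp]: "adj_fst (rad G) = G" "adj_snd (rad G) = G2"
    using rad[of G] by (simp_all add: G2_def)
  note G_facts [simp] = dual_pairD(2-6)[OF dG, simplified]
  have [simp]: "arr (nar F \<alpha> X)" if "X \<in> Ob C" for X
    using \<alpha> that by (simp add: Right_Hom_iff)
  have \<alpha>_nat: "nar F \<alpha> X \<bullet> F \<unrhd> f = f \<bullet> nar F \<alpha> (src f)" if "arr f" "X = tgt f" for f X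
    using \<alpha> that by (simp add: Right_Hom_iff)
  have \<alpha>_mod: "nar F \<alpha> X \<unlhd> Y = nar F \<alpha> (X \<boxtimes> Y) \<bullet> asc F X Y"
    if [simp]: "X \<in> Ob C" "Y \<in> Ob C" for X Y
    using \<alpha> by (simp add: Right_Hom_iff)
  have Psi: "nal F (Psi C rad F \<alpha>) H =
      cnl (rad F) H \<bullet> asc H F G \<bullet>
      cnl (rad G) (H \<boxtimes> F) \<unlhd> G \<bullet> asc (H \<boxtimes> F) G G2 \<unlhd> G \<bullet>
      (((H \<boxtimes> F) \<boxtimes> G) \<unrhd> nar F \<alpha> G2) \<unlhd> G \<bullet> asc ((H \<boxtimes> F) \<boxtimes> G) F G2 \<unlhd> G \<bullet>
      asi (H \<boxtimes> F) G F \<unlhd> G2 \<unlhd> G \<bullet> asi ((H \<boxtimes> F) \<boxtimes> (G \<boxtimes> F)) G2 G \<bullet>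
      unl (rad G) ((H \<boxtimes> F) \<boxtimes> (G \<boxtimes> F)) \<bullet> unl (rad F) (H \<boxtimes> F)"
    if [simp]: "H \<in> Ob C" for H
  proof -
    \<comment> \<open>This left-nested bracketing is how \<open>\<cdot>\<close> groups the factors
      in \<open>Psi_def\<close>, so both sides unfold to the same morphism; \<open>cmp_assoc\<close>
      renests it afterwards.\<close>
    have "nal F (Psi C rad F \<alpha>) H =
      (((((((((cnl (rad F) H \<bullet> asc H F G) \<bullet>
      cnl (rad G) (H \<boxtimes> F) \<unlhd> G) \<bullet> asc (H \<boxtimes> F) G G2 \<unlhd> G) \<bullet>
      (((H \<boxtimes> F) \<boxtimes> G) \<unrhd> nar F \<alpha> G2) \<unlhd> G) \<bullet> asc ((H \<boxtimes> F) \<boxtimes> G) F G2 \<unlhd> G) \<bullet>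
      asi (H \<boxtimes> F) G F \<unlhd> G2 \<unlhd> G) \<bullet> asi ((H \<boxtimes> F) \<boxtimes> (G \<boxtimes> F)) G2 G) \<bullet>
      unl (rad G) ((H \<boxtimes> F) \<boxtimes> (G \<boxtimes> F))) \<bullet> unl (rad F) (H \<boxtimes> F))"
      unfolding Psi_def Let_def nal_def nar_def cnl_def unl_def asc_def asi_def lwh_def rwh_def cmp_def
      by simp
    then show ?thesis by simp
  qed
  then show "arr (nal F (Psi C rad F \<alpha>) X)" if "X \<in> Ob C"
    using that by simp
  note unitF = dual_pair_unit_balance[OF dF, simplified]
  note unitG = dual_pair_unit_balance[OF dG, simplified]
  note counit = dual_pair_counit_balance[OF dF, simplified] dual_pair_counit_balance[OF dG, simplified]
  note binary = unitF unitG asc_lwh_pentagon asc_rwh_inv_pentagon asc_asi_pentagon asi_natural_mid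
    asc_natural_left asc_natural_mid asc_natural_right asc_asi asi_asc lwh_cmp[symmetric] \<alpha>_nat
  \<comment> \<open>Every two-factor rule enters twice: alone, for the end of a composite, and
    through \<open>cmp_reassoc\<close>, for its interior.\<close>
  note rules = binary binary[THEN cmp_reassoc] \<alpha>_mod
  \<comment> \<open>The counit of \<open>rad G\<close> is whiskered by both \<open>G\<close> and \<open>K\<close>; it may be balanced only after these have
    been merged into \<open>G \<boxtimes> K\<close>, hence the two passes.\<close>
  have "nal F (Psi C rad F \<alpha>) H \<unlhd> K = H \<unrhd> nar F \<alpha> K \<bullet> asc H F K"
    if [simp]: "H \<in> Ob C" "K \<in> Ob C" for H K
    using dual_pair_triangle_cmp[OF dG, of G G2 "nar F \<alpha> K" K "asc G F K \<bullet> unr (rad F) K"]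
      dual_pair_mate[OF dF, of F G K "nar F \<alpha> K" K]
    by (simp add: Psi rwh_cmp counit(1) rules, simp add: counit(2) rules)
  then show "balanced F \<alpha> (Psi C rad F \<alpha>)"
    by (simp add: balanced_def)
qed

text \<open>Each required equation is tested after whiskering on the right, where balance turns
  \<beta> into \<alpha>. Naturality becomes the interchange law, and the module condition becomes
  the pentagon together with naturality of the associator.\<close>

lemma balanced_Left_Hom:
  assumes dual: "\<And>X. X \<in> Ob C \<Longrightarrow> \<exists>A. dual_pair A \<and> adj_fst A = X"
    and F [simp]: "F \<in> Ob C" and \<alpha>: "\<alpha> \<in> Right_Hom F" and bal: "balanced F \<alpha> \<beta>"
    and ext: "\<beta> \<in> extensional (Ob C)" and \<beta> [simp]: "\<And>X. X \<in> Ob C \<Longrightarrow> arr (nal F \<beta> X)"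
  shows "\<beta> \<in> Left_Hom F"
proof -
  have faithful: "f = g"
    if "arr f" "arr g" "src f = src g" "tgt f = tgt g" "\<And>X. X \<in> Ob C \<Longrightarrow> f \<unlhd> X = g \<unlhd> X" for f g
  proof -
    obtain A where "dual_pair A" "adj_fst A = tgt f"
      using dual[of "tgt f"] \<open>arr f\<close> by auto
    then show ?thesis
      using that by (auto intro: joint_faithful[of A f g])
  qed
  have [simp]: "arr (nar F \<alpha> X)" if "X \<in> Ob C" for X
    using \<alpha> that by (simp add: Right_Hom_iff)
  have \<beta>_rwh: "nal F \<beta> X \<unlhd> Y = X \<unrhd> nar F \<alpha> Y \<bullet> asc X F Y" if "X \<in> Ob C" "Y \<in> Ob C" for X Y
    using bal that by (simp add: balanced_def)
  have "nal F \<beta> (tgt f) \<bullet> f \<unlhd> F = f \<bullet> nal F \<beta> (src f)" if [simp]: "arr f" for f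
  proof (rule faithful)
    fix X assume [simp]: "X \<in> Ob C"
    show "(nal F \<beta> (tgt f) \<bullet> f \<unlhd> F) \<unlhd> X = (f \<bullet> nal F \<beta> (src f)) \<unlhd> X"
      using whisker_exchange[of f "nar F \<alpha> X" "src f" "tgt f"]
      by (simp add: rwh_cmp \<beta>_rwh asc_natural_left cmp_reassoc[OF whisker_exchange])
  qed simp_all
  moreover have "nal F \<beta> (X \<boxtimes> Y) = X \<unrhd> nal F \<beta> Y \<bullet> asc X Y F"
    if [simp]: "X \<in> Ob C" "Y \<in> Ob C" for X Y
  proof (rule faithful)
    fix Z assume [simp]: "Z \<in> Ob C"
    \<comment> \<open>The pair \<open>asi\<close>, \<open>asc\<close> is inserted so that
      \<open>asc_natural_mid\<close> can expose \<open>nal F \<beta> Y \<unlhd> Z\<close>, which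
      balance replaces by \<alpha>.\<close>
    have "(X \<unrhd> nal F \<beta> Y \<bullet> asc X Y F) \<unlhd> Z =
        asi X Y Z \<bullet> (asc X Y Z \<bullet> (X \<unrhd> nal F \<beta> Y) \<unlhd> Z) \<bullet> asc X Y F \<unlhd> Z"
      by (simp add: rwh_cmp cmp_reassoc[OF asi_asc])
    also have "\<dots> = asi X Y Z \<bullet> (X \<unrhd> Y \<unrhd> nar F \<alpha> Z \<bullet> asc X Y (F \<boxtimes> Z)) \<bullet> asc (X \<boxtimes> Y) F Z"
      by (simp add: asc_natural_mid \<beta>_rwh lwh_cmp asc_pentagon)
    also have "\<dots> = nal F \<beta> (X \<boxtimes> Y) \<unlhd> Z"
      using cmp_reassoc[OF asc_natural_right[of "nar F \<alpha> Z" X Y Z, symmetric], of "asc (X \<boxtimes> Y) F Z"]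
      by (simp add: \<beta>_rwh cmp_reassoc[OF asi_asc])
    finally show "nal F \<beta> (X \<boxtimes> Y) \<unlhd> Z = (X \<unrhd> nal F \<beta> Y \<bullet> asc X Y F) \<unlhd> Z" ..
  qed simp_all
  ultimately show ?thesis
    using ext by (simp add: Left_Hom_iff)
qed

text \<open>Balance prescribes every \<open>nal F \<beta> X \<unlhd> Y\<close>, and
  \<open>joint_faithful\<close> recovers \<open>nal F \<beta> X\<close> from these because its
  target \<open>X\<close> has a right dual.\<close>

lemma balanced_unique:
  assumes dual: "\<And>X. X \<in> Ob C \<Longrightarrow> \<exists>A. dual_pair A \<and> adj_fst A = X"
    and F [simp]: "F \<in> Ob C" and bal: "balanced F \<alpha> \<beta>" "balanced F \<alpha> \<beta>'"
    and \<beta>: "\<beta> \<in> Left_Hom F" and \<beta>': "\<beta>' \<in> Left_Hom F"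
  shows "\<beta> = \<beta>'"
proof -
  have [simp]: "arr (nal F \<beta> X)" "arr (nal F \<beta>' X)" if "X \<in> Ob C" for X
    using \<beta> \<beta>' that by (simp_all add: Left_Hom_iff)
  have "nal F \<beta> X = nal F \<beta>' X" if X: "X \<in> Ob C" for X
  proof -
    obtain A where A: "dual_pair A" "adj_fst A = X"
      using dual[OF X] by auto
    have "nal F \<beta> X \<unlhd> Y = nal F \<beta>' X \<unlhd> Y" if "Y \<in> Ob C" for Y
      using X bal that by (simp add: balanced_def)
    then show ?thesis
      using X A(2) by (intro joint_faithful[OF A(1), of "nal F \<beta> X" "nal F \<beta>' X"]) simp_all
  qed
  then have "\<beta> X = \<beta>' X" if "X \<in> Ob C" for X
    using that by (simp add: nal_def)
  moreover have "\<beta> \<in> extensional (Ob C)" "\<beta>' \<in> extensional (Ob C)"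
    using \<beta> \<beta>' by (simp_all add: Left_Hom_iff)
  ultimately show ?thesis
    by (auto intro: extensionalityI)
qed


section \<open>Translation between the original definitions and the arrow calculus\<close>

lemma adjunction_dual_pair:
  assumes "adjunction K C A"
  shows "dual_pair A"
proof -
  define F G where "F = adj_fst A" "G = adj_snd A"
  note [simp] = F_G_def[symmetric]
  note adj = assms[unfolded adjunction_def Let_def F_G_def[symmetric]]
  have [simp]: "F \<in> Ob C" "G \<in> Ob C"
    using adj by blast+
  have unl: "unit_l A \<in> left_module_transf C (Id_functor C) (tensor_by_right C (G \<boxtimes> F))"
    and cnl: "counit_l A \<in> left_module_transf C (tensor_by_right C (F \<boxtimes> G)) (Id_functor C)"
    and unr: "unit_r A \<in> right_module_transf C (Id_functor C) (tensor_by_left C (G \<boxtimes> F))"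
    and cnr: "counit_r A \<in> right_module_transf C (tensor_by_left C (F \<boxtimes> G)) (Id_functor C)"
    using adj by blast+
  have arrs [simp]: "arr (unl A X)" "arr (unr A X)" "arr (cnl A X)" "arr (cnr A X)"
    if "X \<in> Ob C" for X
    using unl unr cnl cnr that
    by (auto simp: left_module_transf_def right_module_transf_def nat_transf_def Id_functor_def
        tensor_by_left_def tensor_by_right_def arr_Arrow unl_def unr_def cnl_def cnr_def)
  have natural: "unl A (tgt f) \<bullet> f = f \<unlhd> (G \<boxtimes> F) \<bullet> unl A (src f)"
    "unr A (tgt f) \<bullet> f = (G \<boxtimes> F) \<unrhd> f \<bullet> unr A (src f)"
    "cnl A (tgt f) \<bullet> f \<unlhd> (F \<boxtimes> G) = f \<bullet> cnl A (src f)"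
    "cnr A (tgt f) \<bullet> (F \<boxtimes> G) \<unrhd> f = f \<bullet> cnr A (src f)" if "arr f" for f
    using unl unr cnl cnr that
    by (cases f; auto simp: left_module_transf_def right_module_transf_def nat_transf_def
        Id_functor_def tensor_by_left_def tensor_by_right_def arr_Arrow unl_def unr_def cnl_def
        cnr_def cmp_def lwh_def rwh_def)+
  have "triangle_identities C (tensor_by_left C F) (tensor_by_left C G)
      (\<lambda>X\<in>Ob C. associator C G F X \<cdot> unit_r A X)
      (\<lambda>X\<in>Ob C. counit_r A X \<cdot> associator_inv C F G X)"
    and "triangle_identities C (tensor_by_right C G) (tensor_by_right C F)
      (\<lambda>X\<in>Ob C. associator_inv C X G F \<cdot> unit_l A X)
      (\<lambda>X\<in>Ob C. counit_l A X \<cdot> associator C X F G)"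
    using adj by (auto simp: left_module_adjunction_def right_module_adjunction_def)
  \<comment> \<open>The bracketed pairs are the counits of the functor adjunctions, which absorb an
    associator; in this grouping the equations unfold to \<open>triangle_identities\<close>.\<close>
  then have "(cnr A (F \<boxtimes> X) \<bullet> asi F G (F \<boxtimes> X)) \<bullet> F \<unrhd> (asc G F X \<bullet> unr A X) = idn (F \<boxtimes> X)"
    "(cnl A (X \<boxtimes> G) \<bullet> asc (X \<boxtimes> G) F G) \<bullet> (asi X G F \<bullet> unl A X) \<unlhd> G = idn (X \<boxtimes> G)"
    if "X \<in> Ob C" for X
    using that
    by (simp_all add: triangle_identities_def tensor_by_left_def tensor_by_right_def cmp_def idn_def
        lwh_def rwh_def asc_def asi_def unl_def unr_def cnl_def cnr_def)
  then have triangles: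
    "cnr A (F \<boxtimes> X) \<bullet> asi F G (F \<boxtimes> X) \<bullet> F \<unrhd> (asc G F X \<bullet> unr A X) = idn (F \<boxtimes> X)"
    "cnl A (X \<boxtimes> G) \<bullet> asc (X \<boxtimes> G) F G \<bullet> (asi X G F \<bullet> unl A X) \<unlhd> G = idn (X \<boxtimes> G)"
    if "X \<in> Ob C" for X
    using that by simp_all
  have "(cnr A F \<bullet> asi F G F) \<bullet> unl A F = idn F" "(cnl A G \<bullet> asc G F G) \<bullet> unr A G = idn G"
    using adj by (simp_all add: cmp_def idn_def asc_def asi_def unl_def unr_def cnl_def cnr_def)
  then have retractions: "cnr A F \<bullet> asi F G F \<bullet> unl A F = idn F" "cnl A G \<bullet> asc G F G \<bullet> unr A G = idn G"
    by simp_all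
  have "X \<unrhd> unr A Y = asc X (G \<boxtimes> F) Y \<bullet> unl A X \<unlhd> Y"
    "X \<unrhd> cnr A Y \<bullet> asc X (F \<boxtimes> G) Y = cnl A X \<unlhd> Y" if "X \<in> Ob C" "Y \<in> Ob C" for X Y
    using adj that
    by (simp_all add: cmp_def lwh_def rwh_def asc_def unl_def unr_def cnl_def cnr_def)
  with arrs natural triangles retractions show ?thesis
    by (simp add: dual_pair_def Let_def)
qed

text \<open>Sums and scalar multiples are formed in hom-spaces and not on arrows, so linearity
  arguments need the conditions in this form; \<open>balanced_mor\<close> serves the same
  purpose.\<close>

lemma Left_Hom_mor_iff:
  assumes [simp]: "F \<in> Ob C"
  shows "\<beta> \<in> Left_Hom F \<longleftrightarrow>
    \<beta> \<in> extensional (Ob C) \<and> (\<forall>X\<in>Ob C. \<beta> X \<in> mor C (X \<boxtimes> F) X) \<and>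
    (\<forall>X\<in>Ob C. \<forall>Y\<in>Ob C. \<forall>f\<in>mor C X Y. \<beta> Y \<cdot> (f \<triangleleft> F) = f \<cdot> \<beta> X) \<and>
    (\<forall>X\<in>Ob C. \<forall>Y\<in>Ob C. \<beta> (X \<boxtimes> Y) = (X \<triangleright> \<beta> Y) \<cdot> associator C X Y F)"
  by (simp add: Left_Hom_iff all_arr_iff arr_Arrow nal_def cmp_def lwh_def rwh_def asc_def)

lemma balanced_mor:
  "balanced F \<alpha> \<beta> \<longleftrightarrow>
    (\<forall>X\<in>Ob C. \<forall>Y\<in>Ob C. (X \<triangleright> \<alpha> Y) \<cdot> associator C X F Y = \<beta> X \<triangleleft> Y)"
  by (simp add: balanced_def nar_def nal_def cmp_def lwh_def rwh_def asc_def)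

end

section \<open>The reversed category\<close>

text \<open>Composition is kept and only the tensor product is turned round. The associator inverts
  because \<open>(X \<boxtimes> Y) \<boxtimes> Z\<close> formed here is
  \<open>Z \<boxtimes> (Y \<boxtimes> X)\<close> in \<open>C\<close>.\<close>

definition rev_cat ::
  "('o, 'm, 'a, 'z) semigroup_cat_scheme \<Rightarrow> ('o, 'm, 'a, 'z) semigroup_cat_scheme" where
  "rev_cat C = C\<lparr>tensor := \<lambda>X Y. Y \<boxtimes>\<^bsub>C\<^esub> X, tensor_mor := \<lambda>f g. g \<star>\<^bsub>C\<^esub> f,
     associator := \<lambda>X Y Z. associator_inv C Z Y X\<rparr>"

text \<open>Swapping the two objects keeps units as units: formed in \<open>rev_cat C\<close>, the
  target of the new left unit is the target of the old right unit. Thus left duals in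
  \<open>C\<close> become right duals.\<close>

definition rev_adj :: "('o, 'm) adjunction_data \<Rightarrow> ('o, 'm) adjunction_data" where
  "rev_adj A = \<lparr>adj_fst = adj_snd A, adj_snd = adj_fst A, unit_l = unit_r A, unit_r = unit_l A,
     counit_l = counit_r A, counit_r = counit_l A\<rparr>"

lemma rev_cat_simps [simp]:
  "Ob (rev_cat C) = Ob C" "Hom (rev_cat C) = Hom C" "ident (rev_cat C) = ident C"
  "comp_mor (rev_cat C) = comp_mor C"
  "X \<boxtimes>\<^bsub>rev_cat C\<^esub> Y = Y \<boxtimes>\<^bsub>C\<^esub> X" "f \<star>\<^bsub>rev_cat C\<^esub> g = g \<star>\<^bsub>C\<^esub> f"
  "associator (rev_cat C) X Y Z = associator_inv C Z Y X"
  by (simp_all add: rev_cat_def)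

lemma rev_adj_simps [simp]:
  "adj_fst (rev_adj A) = adj_snd A" "adj_snd (rev_adj A) = adj_fst A"
  "unit_l (rev_adj A) = unit_r A" "unit_r (rev_adj A) = unit_l A"
  "counit_l (rev_adj A) = counit_r A" "counit_r (rev_adj A) = counit_l A"
  by (simp_all add: rev_adj_def)

context semigroup_category
begin

lemma associator_inv_natural:
  assumes ob: "X \<in> Ob C" "X' \<in> Ob C" "Y \<in> Ob C" "Y' \<in> Ob C" "Z \<in> Ob C" "Z' \<in> Ob C"
    and mor: "f \<in> mor C X X'" "g \<in> mor C Y Y'" "h \<in> mor C Z Z'"
  shows "associator_inv C X' Y' Z' \<cdot> (f \<star> (g \<star> h)) = ((f \<star> g) \<star> h) \<cdot> associator_inv C X Y Z"
proof -
  \<comment> \<open>A tensor product of three morphisms is not a whiskering, so it is packaged as an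
    arrow by hand to make the cancellation rules available.\<close>
  define t where "t = Arrow ((X \<boxtimes> Y) \<boxtimes> Z) ((f \<star> g) \<star> h) ((X' \<boxtimes> Y') \<boxtimes> Z')"
  define t' where "t' = Arrow (X \<boxtimes> (Y \<boxtimes> Z)) (f \<star> (g \<star> h)) (X' \<boxtimes> (Y' \<boxtimes> Z'))"
  note [simp] = ob
  have [simp]: "arr t" "arr t'"
    using mor by (simp_all add: t_def t'_def arr_Arrow tensor_in_hom)
  have st [simp]: "src t = (X \<boxtimes> Y) \<boxtimes> Z" "tgt t = (X' \<boxtimes> Y') \<boxtimes> Z'"
    "src t' = X \<boxtimes> (Y \<boxtimes> Z)" "tgt t' = X' \<boxtimes> (Y' \<boxtimes> Z')"
    by (simp_all add: t_def t'_def)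
  have nat: "asc X' Y' Z' \<bullet> t = t' \<bullet> asc X Y Z"
    using assoc_natural[OF ob mor] by (simp add: t_def t'_def cmp_def asc_def)
  have "asi X' Y' Z' \<bullet> t' = asi X' Y' Z' \<bullet> (t' \<bullet> asc X Y Z) \<bullet> asi X Y Z"
    by simp
  also have "\<dots> = t \<bullet> asi X Y Z"
    by (simp add: nat[symmetric] cmp_reassoc[OF asi_asc])
  finally show ?thesis
    by (simp add: cmp_def asi_def t_def t'_def)
qed

lemma asi_pentagon:
  assumes [simp]: "W \<in> Ob C" "X \<in> Ob C" "Y \<in> Ob C" "Z \<in> Ob C"
  shows "asi W X Y \<unlhd> Z \<bullet> asi W (X \<boxtimes> Y) Z \<bullet> W \<unrhd> asi X Y Z = asi (W \<boxtimes> X) Y Z \<bullet> asi W X (Y \<boxtimes> Z)"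
proof -
  let ?r = "asi W X Y \<unlhd> Z \<bullet> asi W (X \<boxtimes> Y) Z \<bullet> W \<unrhd> asi X Y Z"
  have l: "W \<unrhd> asc X Y Z \<bullet> W \<unrhd> asi X Y Z = idn (W \<boxtimes> (X \<boxtimes> (Y \<boxtimes> Z)))"
    and r: "asc W X Y \<unlhd> Z \<bullet> asi W X Y \<unlhd> Z = idn ((W \<boxtimes> (X \<boxtimes> Y)) \<boxtimes> Z)"
    by (simp_all add: lwh_cmp[symmetric] rwh_cmp[symmetric])
  \<comment> \<open>The factors inserted in front of \<open>?r\<close> compose to an identity and
    contain one side of the pentagon; replaced by the other side, it cancels \<open>?r\<close>
    factor by factor.\<close>
  have "?r = asi (W \<boxtimes> X) Y Z \<bullet> asi W X (Y \<boxtimes> Z) \<bullet> (asc W X (Y \<boxtimes> Z) \<bullet> asc (W \<boxtimes> X) Y Z) \<bullet> ?r"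
    by (simp add: cmp_reassoc[OF asi_asc])
  also have "\<dots> = asi (W \<boxtimes> X) Y Z \<bullet> asi W X (Y \<boxtimes> Z)"
    by (simp add: asc_pentagon[symmetric] cmp_reassoc[OF r] cmp_reassoc[OF asc_asi] l)
  finally show ?thesis .
qed

text \<open>Naturality and the pentagon become \<open>associator_inv_natural\<close> and
  \<open>asi_pentagon\<close>, the tensor axioms for the left and the right argument trade places,
  and the underlying linear category is unchanged.\<close>

lemma semigroup_category_rev: "semigroup_category K (rev_cat C)"
proof (intro semigroup_category.intro linear_category.intro semigroup_category_axioms.intro)
  fix W X Y Z assume ob: "W \<in> Ob (rev_cat C)" "X \<in> Ob (rev_cat C)" "Y \<in> Ob (rev_cat C)" "Z \<in> Ob (rev_cat C)"
  show "associator (rev_cat C) W X (Y \<boxtimes>\<^bsub>rev_cat C\<^esub> Z) \<cdot>\<^bsub>rev_cat C\<^esub>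
       associator (rev_cat C) (W \<boxtimes>\<^bsub>rev_cat C\<^esub> X) Y Z =
       W \<triangleright>\<^bsub>rev_cat C\<^esub> associator (rev_cat C) X Y Z \<cdot>\<^bsub>rev_cat C\<^esub>
       associator (rev_cat C) W (X \<boxtimes>\<^bsub>rev_cat C\<^esub> Y) Z \<cdot>\<^bsub>rev_cat C\<^esub>
       associator (rev_cat C) W X Y \<triangleleft>\<^bsub>rev_cat C\<^esub> Z"
  proof -
    have "(asi Z Y X \<unlhd> W \<bullet> asi Z (Y \<boxtimes> X) W) \<bullet> Z \<unrhd> asi Y X W = asi (Z \<boxtimes> Y) X W \<bullet> asi Z Y (X \<boxtimes> W)"
      using ob by (simp add: asi_pentagon)
    then show ?thesis by (simp add: asi_def cmp_def lwh_def rwh_def)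
  qed
next
  fix X Y Z assume "X \<in> Ob (rev_cat C)" "Y \<in> Ob (rev_cat C)" "Z \<in> Ob (rev_cat C)"
  then show "isomorphism (rev_cat C) ((X \<boxtimes>\<^bsub>rev_cat C\<^esub> Y) \<boxtimes>\<^bsub>rev_cat C\<^esub> Z)
     (X \<boxtimes>\<^bsub>rev_cat C\<^esub> (Y \<boxtimes>\<^bsub>rev_cat C\<^esub> Z)) (associator (rev_cat C) X Y Z)"
    using associator_inverse_pair[of Z Y X] by (auto simp: isomorphism_def inverse_pair_def)
qed (unfold rev_cat_simps, (rule field_K Hom_module ident_in_hom comp_in_hom ident_left ident_right
      comp_assoc comp_linear_left comp_linear_right tensor_Ob tensor_in_hom tensor_ident tensor_comp
      tensor_linear_left tensor_linear_right associator_inv_natural; assumption)+)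

lemma associator_inv_rev [simp]:
  assumes "X \<in> Ob C" "Y \<in> Ob C" "Z \<in> Ob C"
  shows "associator_inv (rev_cat C) X Y Z = associator C Z Y X"
proof -
  interpret R: semigroup_category K "rev_cat C"
    by (rule semigroup_category_rev)
  show ?thesis
    using associator_inverse_pair[of Z Y X] assms
    by (auto simp: associator_inv_def[of "rev_cat C"] inverse_pair_def intro!: R.inverse_mor_eq)
qed

text \<open>A dictionary between the two arrow calculi. The clause for \<open>asi\<close> asks for
  objects of \<open>C\<close> because \<open>associator_inv\<close> is a definite description,
  evaluated only there.\<close>

lemma rev_arrow_simps:
  "semigroup_category.arr (rev_cat C) = arr"
  "semigroup_category.idn (rev_cat C) = idn"
  "semigroup_category.cmp (rev_cat C) = cmp"
  "semigroup_category.lwh (rev_cat C) X f = f \<unlhd> X"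
  "semigroup_category.rwh (rev_cat C) f X = X \<unrhd> f"
  "semigroup_category.asc (rev_cat C) X Y Z = asi Z Y X"
  "\<lbrakk>X \<in> Ob C; Y \<in> Ob C; Z \<in> Ob C\<rbrakk> \<Longrightarrow> semigroup_category.asi (rev_cat C) X Y Z = asc Z Y X"
  "semigroup_category.unl (rev_cat C) (rev_adj A) = unr A"
  "semigroup_category.unr (rev_cat C) (rev_adj A) = unl A"
  "semigroup_category.cnl (rev_cat C) (rev_adj A) = cnr A"
  "semigroup_category.cnr (rev_cat C) (rev_adj A) = cnl A"
  "semigroup_category.nar (rev_cat C) = nal"
  "semigroup_category.nal (rev_cat C) = nar"
proof -
  interpret R: semigroup_category K "rev_cat C"
    by (rule semigroup_category_rev)
  show "R.arr = arr" "R.idn = idn" "R.cmp = cmp"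
    "R.lwh X f = f \<unlhd> X" "R.rwh f X = X \<unrhd> f" "R.asc X Y Z = asi Z Y X"
    "R.unl (rev_adj A) = unr A" "R.unr (rev_adj A) = unl A"
    "R.cnl (rev_adj A) = cnr A" "R.cnr (rev_adj A) = cnl A" "R.nar = nal" "R.nal = nar"
    by (auto simp: fun_eq_iff R.arr_def arr_def R.idn_def idn_def R.cmp_def cmp_def R.lwh_def lwh_def
        R.rwh_def rwh_def R.asc_def asi_def R.unl_def unl_def R.unr_def unr_def R.cnl_def cnl_def
        R.cnr_def cnr_def R.nar_def nar_def R.nal_def nal_def
        simp del: src_Ob tgt_Ob R.src_Ob R.tgt_Ob)
  show "R.asi X Y Z = asc Z Y X" if "X \<in> Ob C" "Y \<in> Ob C" "Z \<in> Ob C"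
    using that by (simp add: R.asi_def asc_def)
qed

text \<open>The clauses of \<open>dual_pair\<close> are exchanged in pairs, except those of (IV):
  each of these returns with the associator on the other side and is therefore composed with its
  inverse.\<close>

lemma dual_pair_rev:
  assumes A: "dual_pair A"
  shows "semigroup_category.dual_pair (rev_cat C) (rev_adj A)"
proof -
  interpret R: semigroup_category K "rev_cat C"
    by (rule semigroup_category_rev)
  define F G where FG: "F = adj_fst A" "G = adj_snd A"
  note [simp] = FG[symmetric] dual_pairD(1-6)[OF A, folded FG]
  note A' = A[unfolded dual_pair_def Let_def FG[symmetric]]
  have unit: "unl A Y \<unlhd> X = asi Y (G \<boxtimes> F) X \<bullet> Y \<unrhd> unr A X"
    and counit: "cnl A Y \<unlhd> X \<bullet> asi Y (F \<boxtimes> G) X = Y \<unrhd> cnr A X"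
    if [simp]: "X \<in> Ob C" "Y \<in> Ob C" for X Y
  proof -
    have "unl A Y \<unlhd> X = asi Y (G \<boxtimes> F) X \<bullet> asc Y (G \<boxtimes> F) X \<bullet> unl A Y \<unlhd> X"
      by (simp add: cmp_reassoc[OF asi_asc])
    then show "unl A Y \<unlhd> X = asi Y (G \<boxtimes> F) X \<bullet> Y \<unrhd> unr A X"
      using A' by simp
    have "Y \<unrhd> cnr A X = (Y \<unrhd> cnr A X \<bullet> asc Y (F \<boxtimes> G) X) \<bullet> asi Y (F \<boxtimes> G) X"
      by simp
    then show "cnl A Y \<unlhd> X \<bullet> asi Y (F \<boxtimes> G) X = Y \<unrhd> cnr A X"
      using A' by simp
  qed
  then show ?thesis
    using A' by (simp add: R.dual_pair_def Let_def rev_arrow_simps)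
qed

lemma Right_Hom_rev:
  assumes "F \<in> Ob C"
  shows "semigroup_category.Left_Hom (rev_cat C) F = Right_Hom F"
    and "semigroup_category.Right_Hom (rev_cat C) F = Left_Hom F"
proof -
  interpret R: semigroup_category K "rev_cat C"
    by (rule semigroup_category_rev)
  show "R.Left_Hom F = Right_Hom F"
    using assms by (auto simp: R.Left_Hom_iff Right_Hom_iff rev_arrow_simps)
  show "R.Right_Hom F = Left_Hom F"
    using assms by (auto simp: R.Right_Hom_iff Left_Hom_iff rev_arrow_simps)
qed

text \<open>Reversal moves the associator to the other side of the equation, and the typing premises
  let it cancel against its inverse.\<close>

lemma balanced_rev:
  assumes [simp]: "F \<in> Ob C" "\<And>X. X \<in> Ob C \<Longrightarrow> arr (nar F \<alpha> X)" "\<And>X. X \<in> Ob C \<Longrightarrow> arr (nal F \<beta> X)"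
  shows "semigroup_category.balanced (rev_cat C) F \<beta> \<alpha> \<longleftrightarrow> balanced F \<alpha> \<beta>"
proof -
  interpret R: semigroup_category K "rev_cat C"
    by (rule semigroup_category_rev)
  have "nal F \<beta> X \<unlhd> Y \<bullet> asi X F Y = X \<unrhd> nar F \<alpha> Y \<longleftrightarrow> X \<unrhd> nar F \<alpha> Y \<bullet> asc X F Y = nal F \<beta> X \<unlhd> Y"
    if [simp]: "X \<in> Ob C" "Y \<in> Ob C" for X Y
  proof
    assume "nal F \<beta> X \<unlhd> Y \<bullet> asi X F Y = X \<unrhd> nar F \<alpha> Y"
    from this[symmetric] show "X \<unrhd> nar F \<alpha> Y \<bullet> asc X F Y = nal F \<beta> X \<unlhd> Y" by simp
  next
    assume "X \<unrhd> nar F \<alpha> Y \<bullet> asc X F Y = nal F \<beta> X \<unlhd> Y"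
    from this[symmetric] show "nal F \<beta> X \<unlhd> Y \<bullet> asi X F Y = X \<unrhd> nar F \<alpha> Y" by simp
  qed
  then show ?thesis
    by (auto simp: R.balanced_def balanced_def rev_arrow_simps)
qed

text \<open>Under \<open>rev_adj\<close>, the iterated left duals \<open>D\<close> and
  \<open>D2\<close> are the iterated right duals of the reversed category, and the factors of
  \<open>Psi\<close>, brackets included, become those of \<open>Phi\<close>.\<close>

lemma Psi_rev:
  assumes lad: "\<And>F. F \<in> Ob C \<Longrightarrow> dual_pair (lad F) \<and> adj_snd (lad F) = F"
    and [simp]: "F \<in> Ob C"
  shows "Psi (rev_cat C) (\<lambda>F. rev_adj (lad F)) F \<beta> = Phi C lad F \<beta>"
proof -
  have [simp]: "adj_fst (lad F) \<in> Ob C" "adj_snd (lad F) = F" if "F \<in> Ob C" for F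
    using lad[OF that] dual_pairD(1) by auto
  show ?thesis
    by (simp add: Psi_def Phi_def Let_def cong: restrict_cong)
qed

end

section \<open>The presheaves\<close>

lemma linear_mapsD:
  assumes "h \<in> linear_maps K V W"
  shows "x \<in> carrier V \<Longrightarrow> h x \<in> carrier W"
    and "x \<in> carrier V \<Longrightarrow> y \<in> carrier V \<Longrightarrow> h (x \<oplus>\<^bsub>V\<^esub> y) = h x \<oplus>\<^bsub>W\<^esub> h y"
    and "c \<in> carrier K \<Longrightarrow> x \<in> carrier V \<Longrightarrow> h (c \<odot>\<^bsub>V\<^esub> x) = c \<odot>\<^bsub>W\<^esub> h x"
  using assms by (auto simp: linear_maps_def)

text \<open>\<open>linear_maps\<close> has no clause for zero; homogeneity with the scalar zero
  supplies it.\<close>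

lemma linear_maps_zero:
  assumes "h \<in> linear_maps K V W" and "module K V" "module K W"
  shows "h \<zero>\<^bsub>V\<^esub> = \<zero>\<^bsub>W\<^esub>"
proof -
  interpret V: module K V by fact
  interpret W: module K W by fact
  have "h \<zero>\<^bsub>V\<^esub> = h (\<zero>\<^bsub>K\<^esub> \<odot>\<^bsub>V\<^esub> \<zero>\<^bsub>V\<^esub>)"
    by simp
  also have "\<dots> = \<zero>\<^bsub>K\<^esub> \<odot>\<^bsub>W\<^esub> h \<zero>\<^bsub>V\<^esub>"
    by (rule linear_mapsD(3)[OF assms(1)]) simp_all
  also have "\<dots> = \<zero>\<^bsub>W\<^esub>"
    using linear_mapsD(1)[OF assms(1)] by simp
  finally show ?thesis .
qed

context semigroup_category
begin

text \<open>Each of the four lists is ordered as additivity, homogeneity, preservation of zero;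
  later proofs select members by position.\<close>

lemmas comp_right_linear = linear_mapsD(2-3)[OF comp_linear_right] linear_maps_zero[OF comp_linear_right]
lemmas comp_left_linear = linear_mapsD(2-3)[OF comp_linear_left] linear_maps_zero[OF comp_linear_left]
lemmas tensor_right_linear = linear_mapsD(2-3)[OF tensor_linear_right] linear_maps_zero[OF tensor_linear_right]
lemmas tensor_left_linear = linear_mapsD(2-3)[OF tensor_linear_left] linear_maps_zero[OF tensor_linear_left]

section \<open>The vector space of left module transformations\<close>

lemma Left_HomD:
  assumes "\<beta> \<in> Left_Hom F" and "F \<in> Ob C"
  shows "\<beta> \<in> extensional (Ob C)"
    and "X \<in> Ob C \<Longrightarrow> \<beta> X \<in> mor C (X \<boxtimes> F) X"
    and "\<lbrakk>X \<in> Ob C; Y \<in> Ob C; f \<in> mor C X Y\<rbrakk> \<Longrightarrow> \<beta> Y \<cdot> (f \<triangleleft> F) = f \<cdot> \<beta> X"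
    and "\<lbrakk>X \<in> Ob C; Y \<in> Ob C\<rbrakk> \<Longrightarrow> \<beta> (X \<boxtimes> Y) = (X \<triangleright> \<beta> Y) \<cdot> associator C X Y F"
  using assms by (simp_all add: Left_Hom_mor_iff)

lemma associator_in_hom:
  "\<lbrakk>X \<in> Ob C; Y \<in> Ob C; Z \<in> Ob C\<rbrakk> \<Longrightarrow> associator C X Y Z \<in> mor C ((X \<boxtimes> Y) \<boxtimes> Z) (X \<boxtimes> (Y \<boxtimes> Z))"
  using associator_inverse_pair by (auto simp: inverse_pair_def)

lemma whisker_in_hom:
  "\<lbrakk>X \<in> Ob C; Y \<in> Ob C; Z \<in> Ob C; f \<in> mor C X Y\<rbrakk> \<Longrightarrow> f \<triangleleft> Z \<in> mor C (X \<boxtimes> Z) (Y \<boxtimes> Z)"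
  "\<lbrakk>X \<in> Ob C; Y \<in> Ob C; Z \<in> Ob C; f \<in> mor C X Y\<rbrakk> \<Longrightarrow> Z \<triangleright> f \<in> mor C (Z \<boxtimes> X) (Z \<boxtimes> Y)"
  by (auto intro: tensor_in_hom ident_in_hom)

text \<open>Naturality and the module condition are linear in \<beta> because composition and
  \<boxtimes> are bilinear. This gives closure under zero, and under sums and scalar multiples in
  the next two lemmas.\<close>

lemma Left_Hom_zero:
  assumes F [simp]: "F \<in> Ob C"
  shows "(\<lambda>X\<in>Ob C. \<zero>\<^bsub>Hom C (X \<boxtimes> F) X\<^esub>) \<in> Left_Hom F"
proof -
  have z: "\<zero>\<^bsub>Hom C X Y\<^esub> \<in> mor C X Y" if "X \<in> Ob C" "Y \<in> Ob C" for X Y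
    using Hom_module[OF that] by (meson abelian_group.axioms(1) abelian_monoid.zero_closed module.axioms(2))
  have "\<zero>\<^bsub>Hom C (Y \<boxtimes> F) Y\<^esub> \<cdot> (f \<triangleleft> F) = f \<cdot> \<zero>\<^bsub>Hom C (X \<boxtimes> F) X\<^esub>"
    if "X \<in> Ob C" "Y \<in> Ob C" "f \<in> mor C X Y" for X Y f
    using that comp_left_linear(3)[of "X \<boxtimes> F" "Y \<boxtimes> F" Y "f \<triangleleft> F"]
      comp_right_linear(3)[of "X \<boxtimes> F" X Y f]
    by (simp add: Hom_module whisker_in_hom)
  moreover have "\<zero>\<^bsub>Hom C ((X \<boxtimes> Y) \<boxtimes> F) (X \<boxtimes> Y)\<^esub> = (X \<triangleright> \<zero>\<^bsub>Hom C (Y \<boxtimes> F) Y\<^esub>) \<cdot> associator C X Y F"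
    if "X \<in> Ob C" "Y \<in> Ob C" for X Y
    using that comp_left_linear(3)[of "(X \<boxtimes> Y) \<boxtimes> F" "X \<boxtimes> (Y \<boxtimes> F)" "X \<boxtimes> Y" "associator C X Y F"]
      tensor_right_linear(3)[of X X "Y \<boxtimes> F" Y "ident C X"]
    by (simp add: Hom_module associator_in_hom ident_in_hom)
  ultimately show ?thesis
    by (simp add: Left_Hom_mor_iff z)
qed

lemma Left_Hom_add:
  assumes F [simp]: "F \<in> Ob C" and \<beta>: "\<beta> \<in> Left_Hom F" and \<beta>': "\<beta>' \<in> Left_Hom F"
  shows "(\<lambda>X\<in>Ob C. \<beta> X \<oplus>\<^bsub>Hom C (X \<boxtimes> F) X\<^esub> \<beta>' X) \<in> Left_Hom F"
proof -
  note D = Left_HomD[OF \<beta> F] Left_HomD[OF \<beta>' F]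
  have add: "f \<oplus>\<^bsub>Hom C X Y\<^esub> g \<in> mor C X Y" if "X \<in> Ob C" "Y \<in> Ob C" "f \<in> mor C X Y" "g \<in> mor C X Y" for X Y f g
    using Hom_module[OF that(1,2)] that
    by (meson abelian_group.axioms(1) abelian_monoid.a_closed module.axioms(2))
  have "(\<beta> Y \<oplus>\<^bsub>Hom C (Y \<boxtimes> F) Y\<^esub> \<beta>' Y) \<cdot> (f \<triangleleft> F) = f \<cdot> (\<beta> X \<oplus>\<^bsub>Hom C (X \<boxtimes> F) X\<^esub> \<beta>' X)"
    if "X \<in> Ob C" "Y \<in> Ob C" "f \<in> mor C X Y" for X Y f
    using that comp_left_linear(1)[of "X \<boxtimes> F" "Y \<boxtimes> F" Y "f \<triangleleft> F" "\<beta> Y" "\<beta>' Y"]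
      comp_right_linear(1)[of "X \<boxtimes> F" X Y f "\<beta> X" "\<beta>' X"]
    by (simp add: D whisker_in_hom)
  moreover have "\<beta> (X \<boxtimes> Y) \<oplus>\<^bsub>Hom C ((X \<boxtimes> Y) \<boxtimes> F) (X \<boxtimes> Y)\<^esub> \<beta>' (X \<boxtimes> Y) =
      (X \<triangleright> \<beta> Y \<oplus>\<^bsub>Hom C (Y \<boxtimes> F) Y\<^esub> \<beta>' Y) \<cdot> associator C X Y F"
    if "X \<in> Ob C" "Y \<in> Ob C" for X Y
    using that comp_left_linear(1)[of "(X \<boxtimes> Y) \<boxtimes> F" "X \<boxtimes> (Y \<boxtimes> F)" "X \<boxtimes> Y" "associator C X Y F"
        "X \<triangleright> \<beta> Y" "X \<triangleright> \<beta>' Y"]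
      tensor_right_linear(1)[of X X "Y \<boxtimes> F" Y "ident C X" "\<beta> Y" "\<beta>' Y"]
    by (simp add: D whisker_in_hom associator_in_hom ident_in_hom)
  ultimately show ?thesis
    by (simp add: Left_Hom_mor_iff add D)
qed

lemma Left_Hom_smult:
  assumes F [simp]: "F \<in> Ob C" and \<beta>: "\<beta> \<in> Left_Hom F" and c: "c \<in> carrier K"
  shows "(\<lambda>X\<in>Ob C. c \<odot>\<^bsub>Hom C (X \<boxtimes> F) X\<^esub> \<beta> X) \<in> Left_Hom F"
proof -
  note D = Left_HomD[OF \<beta> F]
  have smult: "c \<odot>\<^bsub>Hom C X Y\<^esub> f \<in> mor C X Y" if "X \<in> Ob C" "Y \<in> Ob C" "f \<in> mor C X Y" for X Y f
    using Hom_module[OF that(1,2)] that c by (meson module.smult_closed)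
  have "(c \<odot>\<^bsub>Hom C (Y \<boxtimes> F) Y\<^esub> \<beta> Y) \<cdot> (f \<triangleleft> F) = f \<cdot> (c \<odot>\<^bsub>Hom C (X \<boxtimes> F) X\<^esub> \<beta> X)"
    if "X \<in> Ob C" "Y \<in> Ob C" "f \<in> mor C X Y" for X Y f
    using that c comp_left_linear(2)[of "X \<boxtimes> F" "Y \<boxtimes> F" Y "f \<triangleleft> F" c "\<beta> Y"]
      comp_right_linear(2)[of "X \<boxtimes> F" X Y f c "\<beta> X"]
    by (simp add: D whisker_in_hom)
  moreover have "c \<odot>\<^bsub>Hom C ((X \<boxtimes> Y) \<boxtimes> F) (X \<boxtimes> Y)\<^esub> \<beta> (X \<boxtimes> Y) =
      (X \<triangleright> c \<odot>\<^bsub>Hom C (Y \<boxtimes> F) Y\<^esub> \<beta> Y) \<cdot> associator C X Y F"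
    if "X \<in> Ob C" "Y \<in> Ob C" for X Y
    using that c comp_left_linear(2)[of "(X \<boxtimes> Y) \<boxtimes> F" "X \<boxtimes> (Y \<boxtimes> F)" "X \<boxtimes> Y" "associator C X Y F"
        c "X \<triangleright> \<beta> Y"]
      tensor_right_linear(2)[of X X "Y \<boxtimes> F" Y "ident C X" c "\<beta> Y"]
    by (simp add: D whisker_in_hom associator_in_hom ident_in_hom)
  ultimately show ?thesis
    by (simp add: Left_Hom_mor_iff smult D)
qed

lemma Left_Hom_ops:
  "carrier (left_module_Hom C (tensor_by_right C F) (Id_functor C)) = Left_Hom F"
  "\<zero>\<^bsub>left_module_Hom C (tensor_by_right C F) (Id_functor C)\<^esub> = (\<lambda>X\<in>Ob C. \<zero>\<^bsub>Hom C (X \<boxtimes> F) X\<^esub>)"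
  "\<beta> \<oplus>\<^bsub>left_module_Hom C (tensor_by_right C F) (Id_functor C)\<^esub> \<beta>' =
    (\<lambda>X\<in>Ob C. \<beta> X \<oplus>\<^bsub>Hom C (X \<boxtimes> F) X\<^esub> \<beta>' X)"
  "c \<odot>\<^bsub>left_module_Hom C (tensor_by_right C F) (Id_functor C)\<^esub> \<beta> =
    (\<lambda>X\<in>Ob C. c \<odot>\<^bsub>Hom C (X \<boxtimes> F) X\<^esub> \<beta> X)"
  by (simp_all add: left_module_Hom_def transf_space_def tensor_by_right_def Id_functor_def)

lemma Left_Hom_module:
  assumes F [simp]: "F \<in> Ob C"
  shows "module K (left_module_Hom C (tensor_by_right C F) (Id_functor C))" (is "module K ?V")
proof -
  interpret K: field K by (rule field_K)
  have M: "module K (Hom C (X \<boxtimes> F) X)" if "X \<in> Ob C" for X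
    using that by (simp add: Hom_module)
  note Mab = M[THEN module.axioms(2)]
  note Mm = Mab[THEN abelian_group.axioms(1)]
  note D = Left_HomD[OF _ F]
  have ext: "\<beta> = \<beta>'" if "\<beta> \<in> Left_Hom F" "\<beta>' \<in> extensional (Ob C)" "\<And>X. X \<in> Ob C \<Longrightarrow> \<beta>' X = \<beta> X" for \<beta> \<beta>'
    using that D(1) by (metis extensionalityI)
  \<comment> \<open>Minus one times \<beta> serves as the additive inverse, so its membership in
    \<open>Left_Hom F\<close> comes from \<open>Left_Hom_smult\<close>.\<close>
  have neg: "(\<lambda>X\<in>Ob C. (\<ominus>\<^bsub>K\<^esub> \<one>\<^bsub>K\<^esub> \<odot>\<^bsub>Hom C (X \<boxtimes> F) X\<^esub> \<beta> X) \<oplus>\<^bsub>Hom C (X \<boxtimes> F) X\<^esub> \<beta> X) =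
      (\<lambda>X\<in>Ob C. \<zero>\<^bsub>Hom C (X \<boxtimes> F) X\<^esub>)" if "\<beta> \<in> Left_Hom F" for \<beta>
  proof (rule restrict_ext)
    fix X assume X: "X \<in> Ob C"
    interpret M: module K "Hom C (X \<boxtimes> F) X" by (rule M[OF X])
    show "(\<ominus>\<^bsub>K\<^esub> \<one>\<^bsub>K\<^esub> \<odot>\<^bsub>Hom C (X \<boxtimes> F) X\<^esub> \<beta> X) \<oplus>\<^bsub>Hom C (X \<boxtimes> F) X\<^esub> \<beta> X = \<zero>\<^bsub>Hom C (X \<boxtimes> F) X\<^esub>"
      using D(2)[OF that X] by (simp add: M.smult_l_minus M.l_neg)
  qed
  show ?thesis
  proof (rule moduleI)
    show "cring K" by (rule K.is_cring)
    show "abelian_group ?V"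
    proof (rule abelian_groupI)
      fix \<beta> assume \<beta>: "\<beta> \<in> carrier ?V"
      show "\<exists>\<beta>'\<in>carrier ?V. \<beta>' \<oplus>\<^bsub>?V\<^esub> \<beta> = \<zero>\<^bsub>?V\<^esub>"
        using \<beta> neg[of \<beta>] Left_Hom_smult[OF F, of \<beta> "\<ominus>\<^bsub>K\<^esub> \<one>\<^bsub>K\<^esub>"]
        by (intro bexI[of _ "\<ominus>\<^bsub>K\<^esub> \<one>\<^bsub>K\<^esub> \<odot>\<^bsub>?V\<^esub> \<beta>"]) (simp_all add: Left_Hom_ops cong: restrict_cong)
    qed (auto simp: Left_Hom_ops Left_Hom_zero Left_Hom_add Left_HomD(2) Mm
          abelian_monoid.a_assoc abelian_monoid.a_comm abelian_monoid.l_zero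
          intro!: restrict_ext ext[symmetric])
  qed (auto simp: Left_Hom_ops Left_Hom_smult Left_HomD(2) M module.smult_l_distr
      module.smult_r_distr[OF M]      module.smult_assoc1 module.smult_one intro!: restrict_ext ext[symmetric])
qed

section \<open>Functoriality of the two presheaves\<close>

lemma left_Hom_presheaf: "presheaf K C (left_Hom_presheaf C)"
proof -
  let ?P = "left_Hom_presheaf C"
  have space: "ps_space ?P F = left_module_Hom C (tensor_by_right C F) (Id_functor C)" for F
    by (simp add: left_Hom_presheaf_def)
  have map: "ps_map ?P f \<beta> = (\<lambda>X\<in>Ob C. \<beta> X \<cdot> (X \<triangleright> f))" for f \<beta>
    by (simp add: left_Hom_presheaf_def)
  have closed: "ps_map ?P f \<beta> \<in> Left_Hom F"
    if [simp]: "F \<in> Ob C" "F' \<in> Ob C" and f: "f \<in> mor C F F'" and \<beta>: "\<beta> \<in> Left_Hom F'" for F F' f \<beta>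
  proof -
    define t where "t = Arrow F f F'"
    have t [simp]: "arr t" "src t = F" "tgt t = F'" "X \<triangleright> f = body (X \<unrhd> t)" for X
      using f by (simp_all add: t_def arr_Arrow lwh_def)
    note H = \<beta>[unfolded Left_Hom_iff[OF \<open>F' \<in> Ob C\<close>]]
    have [simp]: "arr (nal F' \<beta> X)" if "X \<in> Ob C" for X
      using H that by simp
    have nal: "nal F (ps_map ?P f \<beta>) X = nal F' \<beta> X \<bullet> X \<unrhd> t" if "X \<in> Ob C" for X
      using that by (simp add: map nal_def cmp_def)
    \<comment> \<open>The interchange law carries \<open>t\<close> past \<open>g\<close>, after
      which naturality of \<beta> applies.\<close>
    have "nal F' \<beta> (tgt g) \<bullet> tgt g \<unrhd> t \<bullet> g \<unlhd> F = g \<bullet> nal F' \<beta> (src g) \<bullet> src g \<unrhd> t" if "arr g" for g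
      using H that cmp_reassoc[of "nal F' \<beta> (tgt g)" "g \<unlhd> F'" "g \<bullet> nal F' \<beta> (src g)" "src g \<unrhd> t"]
      by (simp add: whisker_exchange[of g t])
    moreover have "nal F' \<beta> (X \<boxtimes> Y) \<bullet> (X \<boxtimes> Y) \<unrhd> t = X \<unrhd> (nal F' \<beta> Y \<bullet> Y \<unrhd> t) \<bullet> asc X Y F"
      if "X \<in> Ob C" "Y \<in> Ob C" for X Y
      using H that by (simp add: lwh_cmp asc_natural_right)
    ultimately show ?thesis
      by (simp add: Left_Hom_iff nal) (simp add: map)
  qed
  show ?thesis
    unfolding presheaf_def
  proof (intro conjI ballI)
    fix F assume F: "F \<in> Ob C"
    show "module K (ps_space ?P F)"
      using F by (simp add: space Left_Hom_module)
    fix \<beta> assume \<beta>: "\<beta> \<in> carrier (ps_space ?P F)"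
    then have \<beta>': "\<beta> \<in> Left_Hom F" by (simp add: space Left_Hom_ops)
    have "\<beta> X \<cdot> (X \<triangleright> ident C F) = \<beta> X" if "X \<in> Ob C" for X
      using F that Left_HomD(2)[OF \<beta>' F that] ident_right[of "X \<boxtimes> F" X "\<beta> X"] by (simp add: tensor_ident)
    then show "ps_map ?P (ident C F) \<beta> = \<beta>"
      using Left_HomD(1)[OF \<beta>' F] by (auto simp: map intro: extensionalityI)
  next
    fix F F' f assume F: "F \<in> Ob C" and F': "F' \<in> Ob C" and f: "f \<in> mor C F F'"
    have "(\<lambda>X\<in>Ob C. (\<beta> X \<oplus>\<^bsub>Hom C (X \<boxtimes> F') X\<^esub> \<beta>' X) \<cdot> (X \<triangleright> f)) =
        (\<lambda>X\<in>Ob C. (\<beta> X \<cdot> (X \<triangleright> f)) \<oplus>\<^bsub>Hom C (X \<boxtimes> F) X\<^esub> (\<beta>' X \<cdot> (X \<triangleright> f)))"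
      if "\<beta> \<in> Left_Hom F'" "\<beta>' \<in> Left_Hom F'" for \<beta> \<beta>'
      using F F' f that by (intro restrict_ext comp_left_linear(1)) (simp_all add: whisker_in_hom Left_HomD(2))
    moreover have "(\<lambda>X\<in>Ob C. (c \<odot>\<^bsub>Hom C (X \<boxtimes> F') X\<^esub> \<beta> X) \<cdot> (X \<triangleright> f)) =
        (\<lambda>X\<in>Ob C. c \<odot>\<^bsub>Hom C (X \<boxtimes> F) X\<^esub> (\<beta> X \<cdot> (X \<triangleright> f)))"
      if "\<beta> \<in> Left_Hom F'" "c \<in> carrier K" for \<beta> c
      using F F' f that by (intro restrict_ext comp_left_linear(2)) (simp_all add: whisker_in_hom Left_HomD(2))
    ultimately show "ps_map ?P f \<in> linear_maps K (ps_space ?P F') (ps_space ?P F)"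
      using closed[OF F F' f] by (auto simp: linear_maps_def space Left_Hom_ops map cong: restrict_cong)
  next
    fix F F' F'' f g \<beta>
    assume ob: "F \<in> Ob C" "F' \<in> Ob C" "F'' \<in> Ob C" and f: "f \<in> mor C F F'" and g: "g \<in> mor C F' F''"
      and \<beta>: "\<beta> \<in> carrier (ps_space ?P F'')"
    then have \<beta>': "\<beta> \<in> Left_Hom F''" by (simp add: space Left_Hom_ops)
    have "\<beta> X \<cdot> (X \<triangleright> (g \<cdot> f)) = \<beta> X \<cdot> (X \<triangleright> g) \<cdot> (X \<triangleright> f)" if X: "X \<in> Ob C" for X
      using ob f g X Left_HomD(2)[OF \<beta>' _ X]
        tensor_comp[of X X X F F' F'' "ident C X" "ident C X" f g] ident_left[OF X X ident_in_hom[OF X]]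
        comp_assoc[of "X \<boxtimes> F" "X \<boxtimes> F'" "X \<boxtimes> F''" X "X \<triangleright> f" "X \<triangleright> g" "\<beta> X"]
      by (simp add: whisker_in_hom ident_in_hom)
    then show "ps_map ?P (g \<cdot> f) \<beta> = ps_map ?P f (ps_map ?P g \<beta>)"
      by (simp add: map cong: restrict_cong)
  next
    fix F F' \<beta> assume F: "F \<in> Ob C" and F': "F' \<in> Ob C" and \<beta>: "\<beta> \<in> carrier (ps_space ?P F')"
    then have \<beta>': "\<beta> \<in> Left_Hom F'" by (simp add: space Left_Hom_ops)
    \<comment> \<open>Linearity in the morphism acting, the last clause of \<open>presheaf\<close>:
      first tensoring with \<open>X\<close> distributes, then composition with
      \<open>\<beta> X\<close>.\<close>
    have "\<beta> X \<cdot> (X \<triangleright> f \<oplus>\<^bsub>Hom C F F'\<^esub> g) = (\<beta> X \<cdot> (X \<triangleright> f)) \<oplus>\<^bsub>Hom C (X \<boxtimes> F) X\<^esub> (\<beta> X \<cdot> (X \<triangleright> g))"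
      if "X \<in> Ob C" "f \<in> mor C F F'" "g \<in> mor C F F'" for X f g
      using that F F' Left_HomD(2)[OF \<beta>' F'] tensor_right_linear(1)[of X X F F' "ident C X" f g]
        comp_right_linear(1)[of "X \<boxtimes> F" "X \<boxtimes> F'" X "\<beta> X" "X \<triangleright> f" "X \<triangleright> g"]
      by (simp add: whisker_in_hom ident_in_hom)
    moreover have "\<beta> X \<cdot> (X \<triangleright> c \<odot>\<^bsub>Hom C F F'\<^esub> f) = c \<odot>\<^bsub>Hom C (X \<boxtimes> F) X\<^esub> (\<beta> X \<cdot> (X \<triangleright> f))"
      if "X \<in> Ob C" "f \<in> mor C F F'" "c \<in> carrier K" for X f c
      using that F F' Left_HomD(2)[OF \<beta>' F'] tensor_right_linear(2)[of X X F F' "ident C X" c f]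
        comp_right_linear(2)[of "X \<boxtimes> F" "X \<boxtimes> F'" X "\<beta> X" c "X \<triangleright> f"]
      by (simp add: whisker_in_hom ident_in_hom)
    ultimately show "(\<lambda>f. ps_map ?P f \<beta>) \<in> linear_maps K (Hom C F F') (ps_space ?P F)"
      using closed[OF F F' _ \<beta>'] by (auto simp: linear_maps_def space Left_Hom_ops map cong: restrict_cong)
  qed
qed


text \<open>Once the tensor product is reversed both records have the same fields, so the right-hand
  presheaf inherits its vector space axioms and functoriality from the left-hand one.\<close>

lemma right_Hom_presheaf_rev:
  "right_Hom_presheaf C = left_Hom_presheaf (rev_cat C)"
proof -
  have "right_module_transf C (tensor_by_left C F) (Id_functor C) =
      left_module_transf (rev_cat C) (tensor_by_right (rev_cat C) F) (Id_functor (rev_cat C))" for F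
    by (auto simp: right_module_transf_def left_module_transf_def nat_transf_def
        tensor_by_left_def tensor_by_right_def Id_functor_def)
  then show ?thesis
    by (simp add: right_Hom_presheaf_def left_Hom_presheaf_def right_module_Hom_def
        left_module_Hom_def transf_space_def tensor_by_left_def tensor_by_right_def Id_functor_def)
qed

lemma presheaf_rev: "presheaf K (rev_cat C) P \<longleftrightarrow> presheaf K C P"
  by (simp add: presheaf_def)

lemma right_Hom_presheaf: "presheaf K C (right_Hom_presheaf C)"
  using semigroup_category.left_Hom_presheaf[OF semigroup_category_rev]
  by (simp add: presheaf_rev right_Hom_presheaf_rev)

lemma carrier_Hom_presheaf:
  "carrier (ps_space (left_Hom_presheaf C) F) = Left_Hom F"
  "carrier (ps_space (right_Hom_presheaf C) F) = Right_Hom F"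
  by (simp_all add: left_Hom_presheaf_def right_Hom_presheaf_def left_module_Hom_def
      right_module_Hom_def transf_space_def)

section \<open>Linearity and naturality through balanced pairs\<close>

lemma presheaf_closed:
  assumes "presheaf K C P" and "X \<in> Ob C" "Y \<in> Ob C"
  shows "\<lbrakk>x \<in> carrier (ps_space P X); y \<in> carrier (ps_space P X)\<rbrakk> \<Longrightarrow>
      x \<oplus>\<^bsub>ps_space P X\<^esub> y \<in> carrier (ps_space P X)"
    and "\<lbrakk>c \<in> carrier K; x \<in> carrier (ps_space P X)\<rbrakk> \<Longrightarrow>
      c \<odot>\<^bsub>ps_space P X\<^esub> x \<in> carrier (ps_space P X)"
    and "\<lbrakk>f \<in> mor C X Y; y \<in> carrier (ps_space P Y)\<rbrakk> \<Longrightarrow> ps_map P f y \<in> carrier (ps_space P X)"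
proof -
  interpret module K "ps_space P X"
    using assms by (simp add: presheaf_def)
  show "\<lbrakk>x \<in> carrier (ps_space P X); y \<in> carrier (ps_space P X)\<rbrakk> \<Longrightarrow>
      x \<oplus>\<^bsub>ps_space P X\<^esub> y \<in> carrier (ps_space P X)"
    by simp
  show "\<lbrakk>c \<in> carrier K; x \<in> carrier (ps_space P X)\<rbrakk> \<Longrightarrow>
      c \<odot>\<^bsub>ps_space P X\<^esub> x \<in> carrier (ps_space P X)"
    by simp
  show "\<lbrakk>f \<in> mor C X Y; y \<in> carrier (ps_space P Y)\<rbrakk> \<Longrightarrow> ps_map P f y \<in> carrier (ps_space P X)"
    using assms linear_mapsD(1)[of "ps_map P f" K "ps_space P Y" "ps_space P X" y] by (simp add: presheaf_def)
qed

text \<open>Linearity and naturality of \<open>\<theta>'\<close> are checked after applying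
  \<theta>, which is injective because \<open>\<theta>'\<close> is a left inverse. This reduces the
  theorem to showing that one of the two maps is a morphism.\<close>

lemma presheaf_morphism_inverse:
  assumes \<theta>: "presheaf_morphism K C P Q \<theta>"
    and \<theta>': "\<And>X y. \<lbrakk>X \<in> Ob C; y \<in> carrier (ps_space Q X)\<rbrakk> \<Longrightarrow> \<theta>' X y \<in> carrier (ps_space P X)"
    and \<theta>'\<theta>: "\<And>X x. \<lbrakk>X \<in> Ob C; x \<in> carrier (ps_space P X)\<rbrakk> \<Longrightarrow> \<theta>' X (\<theta> X x) = x"
    and \<theta>\<theta>': "\<And>X y. \<lbrakk>X \<in> Ob C; y \<in> carrier (ps_space Q X)\<rbrakk> \<Longrightarrow> \<theta> X (\<theta>' X y) = y"
  shows "mutually_inverse_presheaf_isos K C P Q \<theta> \<theta>'"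
proof -
  have P: "presheaf K C P" and Q: "presheaf K C Q"
    and lin: "X \<in> Ob C \<Longrightarrow> \<theta> X \<in> linear_maps K (ps_space P X) (ps_space Q X)"
    and nat: "\<lbrakk>X \<in> Ob C; Y \<in> Ob C; f \<in> mor C X Y; x \<in> carrier (ps_space P Y)\<rbrakk> \<Longrightarrow>
      \<theta> X (ps_map P f x) = ps_map Q f (\<theta> Y x)" for X Y f x
    using \<theta> by (auto simp: presheaf_morphism_def)
  have inj: "x = x'" if "X \<in> Ob C" "x \<in> carrier (ps_space P X)" "x' \<in> carrier (ps_space P X)"
    "\<theta> X x = \<theta> X x'" for X x x'
    using that \<theta>'\<theta> by metis
  have "\<theta>' X \<in> linear_maps K (ps_space Q X) (ps_space P X)" if X: "X \<in> Ob C" for X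
    unfolding linear_maps_def
    by (auto simp: X \<theta>' \<theta>\<theta>' presheaf_closed[OF P X X] presheaf_closed[OF Q X X] linear_mapsD[OF lin[OF X]]
        intro!: inj[OF X])
  moreover have "\<theta>' X (ps_map Q f y) = ps_map P f (\<theta>' Y y)"
    if "X \<in> Ob C" "Y \<in> Ob C" "f \<in> mor C X Y" "y \<in> carrier (ps_space Q Y)" for X Y f y
    using that by (auto simp: \<theta>' \<theta>\<theta>' nat presheaf_closed[OF P] presheaf_closed[OF Q] intro!: inj)
  ultimately show ?thesis
    using \<theta> P Q \<theta>'\<theta> \<theta>\<theta>' by (simp add: mutually_inverse_presheaf_isos_def presheaf_morphism_def)
qed

text \<open>One side of the balance condition is linear in \<alpha>, the other in \<beta>. Together
  with uniqueness of partners this yields linearity of \<open>Psi\<close> without touching its long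
  composite.\<close>

lemma balanced_linear:
  assumes [simp]: "F \<in> Ob C" and \<alpha>: "\<alpha> \<in> Right_Hom F" and \<beta>: "\<beta> \<in> Left_Hom F"
    and bal: "balanced F \<alpha> \<beta>"
  shows "\<lbrakk>\<alpha>' \<in> Right_Hom F; \<beta>' \<in> Left_Hom F; balanced F \<alpha>' \<beta>'\<rbrakk> \<Longrightarrow> balanced F
      (\<alpha> \<oplus>\<^bsub>ps_space (right_Hom_presheaf C) F\<^esub> \<alpha>') (\<beta> \<oplus>\<^bsub>ps_space (left_Hom_presheaf C) F\<^esub> \<beta>')"
    and "c \<in> carrier K \<Longrightarrow> balanced F
      (c \<odot>\<^bsub>ps_space (right_Hom_presheaf C) F\<^esub> \<alpha>) (c \<odot>\<^bsub>ps_space (left_Hom_presheaf C) F\<^esub> \<beta>)"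
proof -
  have \<alpha>_mor: "\<alpha> X \<in> mor C (F \<boxtimes> X) X" if "\<alpha> \<in> Right_Hom F" "X \<in> Ob C" for \<alpha> X
    using that by (simp add: Right_Hom_iff arr_Arrow nar_def)
  note mors = \<alpha>_mor \<alpha>_mor[OF \<alpha>] Left_HomD(2) Left_HomD(2)[OF \<beta>]
  note ops = left_Hom_presheaf_def right_Hom_presheaf_def right_module_Hom_def left_module_Hom_def
    transf_space_def tensor_by_left_def tensor_by_right_def Id_functor_def
  have "(X \<triangleright> \<alpha> Y \<oplus>\<^bsub>Hom C (F \<boxtimes> Y) Y\<^esub> \<alpha>' Y) \<cdot> associator C X F Y =
      (\<beta> X \<oplus>\<^bsub>Hom C (X \<boxtimes> F) X\<^esub> \<beta>' X) \<triangleleft> Y"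
    if "X \<in> Ob C" "Y \<in> Ob C" "\<alpha>' \<in> Right_Hom F" "\<beta>' \<in> Left_Hom F" "balanced F \<alpha>' \<beta>'" for X Y
    using that bal tensor_right_linear(1)[of X X "F \<boxtimes> Y" Y "ident C X" "\<alpha> Y" "\<alpha>' Y"]
      tensor_left_linear(1)[of "X \<boxtimes> F" X Y Y "ident C Y" "\<beta> X" "\<beta>' X"]
      comp_left_linear(1)[of "(X \<boxtimes> F) \<boxtimes> Y" "X \<boxtimes> (F \<boxtimes> Y)" "X \<boxtimes> Y" "associator C X F Y"
        "X \<triangleright> \<alpha> Y" "X \<triangleright> \<alpha>' Y"]
    by (simp add: balanced_mor mors associator_in_hom whisker_in_hom ident_in_hom)
  then show "balanced F
      (\<alpha> \<oplus>\<^bsub>ps_space (right_Hom_presheaf C) F\<^esub> \<alpha>') (\<beta> \<oplus>\<^bsub>ps_space (left_Hom_presheaf C) F\<^esub> \<beta>')"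
    if "\<alpha>' \<in> Right_Hom F" "\<beta>' \<in> Left_Hom F" "balanced F \<alpha>' \<beta>'"
    using that by (simp add: balanced_mor ops)
  have "(X \<triangleright> c \<odot>\<^bsub>Hom C (F \<boxtimes> Y) Y\<^esub> \<alpha> Y) \<cdot> associator C X F Y =
      (c \<odot>\<^bsub>Hom C (X \<boxtimes> F) X\<^esub> \<beta> X) \<triangleleft> Y"
    if "X \<in> Ob C" "Y \<in> Ob C" "c \<in> carrier K" for X Y
    using that bal tensor_right_linear(2)[of X X "F \<boxtimes> Y" Y "ident C X" c "\<alpha> Y"]
      tensor_left_linear(2)[of "X \<boxtimes> F" X Y Y "ident C Y" c "\<beta> X"]
      comp_left_linear(2)[of "(X \<boxtimes> F) \<boxtimes> Y" "X \<boxtimes> (F \<boxtimes> Y)" "X \<boxtimes> Y" "associator C X F Y" c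
        "X \<triangleright> \<alpha> Y"]
    by (simp add: balanced_mor mors associator_in_hom whisker_in_hom ident_in_hom)
  then show "balanced F
      (c \<odot>\<^bsub>ps_space (right_Hom_presheaf C) F\<^esub> \<alpha>) (c \<odot>\<^bsub>ps_space (left_Hom_presheaf C) F\<^esub> \<beta>)"
    if "c \<in> carrier K"
    using that by (simp add: balanced_mor ops)
qed

text \<open>Naturality of the associator in its middle argument carries \<open>t\<close> from one
  side of the balance condition to the other; with uniqueness of partners this yields naturality of
  \<open>Psi\<close> in \<open>F\<close>.\<close>

lemma balanced_natural:
  assumes [simp]: "F \<in> Ob C" "F' \<in> Ob C" and f: "f \<in> mor C F F'"
    and \<alpha>: "\<alpha> \<in> Right_Hom F'" and \<beta>: "\<beta> \<in> Left_Hom F'" and bal: "balanced F' \<alpha> \<beta>"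
  shows "balanced F (ps_map (right_Hom_presheaf C) f \<alpha>) (ps_map (left_Hom_presheaf C) f \<beta>)"
proof -
  define t where "t = Arrow F f F'"
  have [simp]: "arr t" "src t = F" "tgt t = F'"
    using f by (simp_all add: t_def arr_Arrow)
  have [simp]: "arr (nar F' \<alpha> X)" "arr (nal F' \<beta> X)" if "X \<in> Ob C" for X
    using \<alpha> \<beta> that by (simp_all add: Right_Hom_iff Left_Hom_iff)
  have [simp]: "nar F (ps_map (right_Hom_presheaf C) f \<alpha>) X = nar F' \<alpha> X \<bullet> t \<unlhd> X"
    "nal F (ps_map (left_Hom_presheaf C) f \<beta>) X = nal F' \<beta> X \<bullet> X \<unrhd> t" if "X \<in> Ob C" for X
    using that by (simp_all add: right_Hom_presheaf_def left_Hom_presheaf_def nar_def nal_def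
        cmp_def lwh_def rwh_def t_def)
  have "X \<unrhd> (nar F' \<alpha> Y \<bullet> t \<unlhd> Y) \<bullet> asc X F Y = (nal F' \<beta> X \<bullet> X \<unrhd> t) \<unlhd> Y"
    if [simp]: "X \<in> Ob C" "Y \<in> Ob C" for X Y
  proof -
    have "X \<unrhd> (nar F' \<alpha> Y \<bullet> t \<unlhd> Y) \<bullet> asc X F Y =
        (X \<unrhd> nar F' \<alpha> Y \<bullet> asc X F' Y) \<bullet> (X \<unrhd> t) \<unlhd> Y"
      by (simp add: lwh_cmp asc_natural_mid)
    also have "\<dots> = (nal F' \<beta> X \<bullet> X \<unrhd> t) \<unlhd> Y"
      \<comment> \<open>The balance equation has to rewrite its bracketed left side before
        \<open>cmp_assoc\<close> dissolves the bracket.\<close>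
      using bal that by (simp only: balanced_def) (simp add: rwh_cmp)
    finally show ?thesis .
  qed
  then show ?thesis
    by (simp add: balanced_def)
qed

section \<open>The two maps between spaces of transformations\<close>

lemma Psi_Left_Hom:
  assumes rad: "\<And>F. F \<in> Ob C \<Longrightarrow> dual_pair (rad F) \<and> adj_fst (rad F) = F"
    and "F \<in> Ob C" and "\<alpha> \<in> Right_Hom F"
  shows "Psi C rad F \<alpha> \<in> Left_Hom F"
proof (rule balanced_Left_Hom)
  show "\<exists>A. dual_pair A \<and> adj_fst A = X" if "X \<in> Ob C" for X
    using rad[OF that] by blast
  show "Psi C rad F \<alpha> \<in> extensional (Ob C)"
    by (simp add: Psi_def Let_def)
qed (use assms balanced_Psi in auto)

lemma Phi_Right_Hom:
  assumes lad: "\<And>F. F \<in> Ob C \<Longrightarrow> dual_pair (lad F) \<and> adj_snd (lad F) = F"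
    and F: "F \<in> Ob C" and \<beta>: "\<beta> \<in> Left_Hom F"
  shows "Phi C lad F \<beta> \<in> Right_Hom F" and "balanced F (Phi C lad F \<beta>) \<beta>"
proof -
  interpret R: semigroup_category K "rev_cat C"
    by (rule semigroup_category_rev)
  \<comment> \<open>The reversed left adjunctions form a choice of right duals in
    \<open>rev_cat C\<close>, to which the results on \<open>Psi\<close> apply.\<close>
  define rad where "rad F = rev_adj (lad F)" for F
  have rad: "R.dual_pair (rad F) \<and> adj_fst (rad F) = F" if "F \<in> Ob (rev_cat C)" for F
    using lad that dual_pair_rev by (simp add: rad_def)
  have eq: "Psi (rev_cat C) rad F \<beta> = Phi C lad F \<beta>"
    unfolding rad_def using Psi_rev[OF lad F] .
  have \<beta>': "\<beta> \<in> R.Right_Hom F"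
    using F \<beta> by (simp add: Right_Hom_rev)
  show \<alpha>: "Phi C lad F \<beta> \<in> Right_Hom F"
    using R.Psi_Left_Hom[OF rad _ \<beta>'] F by (simp add: eq Right_Hom_rev)
  have "R.balanced F \<beta> (Phi C lad F \<beta>)"
    using R.balanced_Psi(1)[OF rad _ \<beta>'] F by (simp add: eq)
  then show "balanced F (Phi C lad F \<beta>) \<beta>"
    using F \<alpha> \<beta> by (subst (asm) balanced_rev) (simp_all add: Right_Hom_iff Left_Hom_iff)
qed

text \<open>The mirror image of \<open>balanced_unique\<close>: left duals make the functors
  \<open>X \<boxtimes> -\<close> jointly faithful.\<close>

lemma balanced_unique_right:
  assumes dual: "\<And>X. X \<in> Ob C \<Longrightarrow> \<exists>A. dual_pair A \<and> adj_snd A = X"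
    and F: "F \<in> Ob C" and bal: "balanced F \<alpha> \<beta>" "balanced F \<alpha>' \<beta>"
    and \<alpha>: "\<alpha> \<in> Right_Hom F" and \<alpha>': "\<alpha>' \<in> Right_Hom F" and \<beta>: "\<beta> \<in> Left_Hom F"
  shows "\<alpha> = \<alpha>'"
proof -
  interpret R: semigroup_category K "rev_cat C"
    by (rule semigroup_category_rev)
  show ?thesis
  proof (rule R.balanced_unique)
    show "\<exists>A. R.dual_pair A \<and> adj_fst A = X" if X: "X \<in> Ob (rev_cat C)" for X
    proof -
      obtain A where "dual_pair A" "adj_snd A = X"
        using dual X by auto
      then show ?thesis
        by (intro exI[of _ "rev_adj A"]) (simp add: dual_pair_rev)
    qed
    show "R.balanced F \<beta> \<alpha>" "R.balanced F \<beta> \<alpha>'"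
      using bal \<alpha> \<alpha>' \<beta> F by (simp_all add: balanced_rev Right_Hom_iff Left_Hom_iff)
  qed (use F \<alpha> \<alpha>' in \<open>simp_all add: Right_Hom_rev\<close>)
qed

end

theorem theorem2p29:
  fixes K :: "('a, 'r) ring_scheme"
    and C :: "('o, 'm, 'a, 'z) semigroup_cat_scheme"
    and rad lad :: "'o \<Rightarrow> ('o, 'm) adjunction_data"
  assumes "semigroup_category K C"
    and "rigid K C"
    and "right_dual_choice K C rad"
    and "left_dual_choice K C lad"
  shows "mutually_inverse_presheaf_isos K C (right_Hom_presheaf C) (left_Hom_presheaf C)
           (Psi C rad) (Phi C lad)"
proof -
  interpret semigroup_category K C by fact
  have rad: "dual_pair (rad F) \<and> adj_fst (rad F) = F"
    and lad: "dual_pair (lad F) \<and> adj_snd (lad F) = F" if "F \<in> Ob C" for F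
    using assms(3,4) that adjunction_dual_pair by (auto simp: right_dual_choice_def left_dual_choice_def)
  note carriers = carrier_Hom_presheaf
  note Psi = Psi_Left_Hom[OF rad] balanced_Psi(1)[OF rad]
  note Phi = Phi_Right_Hom[OF lad]
  note closed = presheaf_closed[OF left_Hom_presheaf, unfolded carriers]
    presheaf_closed[OF right_Hom_presheaf, unfolded carriers]
  \<comment> \<open>Uniqueness turns every equation for \<open>Psi\<close> below into exhibiting a
    balanced pair whose second member is the desired value.\<close>
  have unique: "Psi C rad F \<alpha> = \<beta>"
    if "F \<in> Ob C" "\<alpha> \<in> Right_Hom F" "\<beta> \<in> Left_Hom F" "balanced F \<alpha> \<beta>" for F \<alpha> \<beta>
    using that rad Psi by (intro balanced_unique[of F \<alpha> "Psi C rad F \<alpha>" \<beta>]) blast+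
  show ?thesis
  proof (rule presheaf_morphism_inverse)
    show "presheaf_morphism K C (right_Hom_presheaf C) (left_Hom_presheaf C) (Psi C rad)"
      unfolding presheaf_morphism_def
    proof (intro conjI ballI)
      show "Psi C rad F \<in> linear_maps K (ps_space (right_Hom_presheaf C) F)
          (ps_space (left_Hom_presheaf C) F)" if "F \<in> Ob C" for F
        unfolding linear_maps_def using that
        by (auto simp: carriers Psi closed(1,2,4,5) intro!: unique balanced_linear)
      show "Psi C rad F (ps_map (right_Hom_presheaf C) f \<alpha>) =
          ps_map (left_Hom_presheaf C) f (Psi C rad F' \<alpha>)"
        if "F \<in> Ob C" "F' \<in> Ob C" "f \<in> mor C F F'"
          "\<alpha> \<in> carrier (ps_space (right_Hom_presheaf C) F')" for F F' f \<alpha>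
        using that
        by (intro unique balanced_natural[of F F'] closed(3)[of F F'] closed(6)[of F F'])
          (simp_all add: carriers Psi)
    qed (fact right_Hom_presheaf left_Hom_presheaf)+
    show "Phi C lad F \<beta> \<in> carrier (ps_space (right_Hom_presheaf C) F)"
      "Psi C rad F (Phi C lad F \<beta>) = \<beta>"
      if "F \<in> Ob C" "\<beta> \<in> carrier (ps_space (left_Hom_presheaf C) F)" for F \<beta>
      using that by (auto simp: carriers Phi intro!: unique)
    \<comment> \<open>Both sides are balanced against \<open>Psi C rad F \<alpha>\<close>, so
      uniqueness on the right identifies them.\<close>
    show "Phi C lad F (Psi C rad F \<alpha>) = \<alpha>"
      if "F \<in> Ob C" "\<alpha> \<in> carrier (ps_space (right_Hom_presheaf C) F)" for F \<alpha>
    proof (rule balanced_unique_right[where F = F and \<beta> = "Psi C rad F \<alpha>"])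
      show "\<exists>A. dual_pair A \<and> adj_snd A = X" if "X \<in> Ob C" for X
        using lad[OF that] by blast
    qed (use that in \<open>simp_all add: carriers Psi Phi\<close>)
  qed
qed

end
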